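(* Consider a logarithmic rank 2 $(TE)$-structure over a point $t^0$, with leading exponents $\alpha_1^0,\alpha_2^0$ (so in the case $N^{\mathrm{mon}}=0$, $\alpha_1^0,\alpha_2^0\in\mathbb C$ are arbitrary, and in the case $N^{\mathrm{mon}}\neq0$ they satisfy $\alpha_1^0-\alpha_2^0\in\mathbb N_0$). Its unfoldings within the set of $(TE)$-structures over $(\mathbb C^2,0)$ in the list (i)–(iv) of the context are precisely those with $c_1=0$ and $\rho^{(1)}=\frac{\alpha_1^0+\alpha_2^0}2$ which satisfy the following further conditions (invariants not restricted here are arbitrary in their definition domains): • generic type (Sem), $k_2>k_1$ (invariants $k_1,k_2$, and $\zeta$ if $k_2-k_1\in2\mathbb N$): $N^{\mathrm{mon}}=0$ and $\alpha_1^0-\alpha_2^0=\pm\frac{k_1-k_2}{k_1+k_2}$; • generic type (Sem), $k_2=k_1$ (invariants $k_1,k_2,\alpha_3$): $N^{\mathrm{mon}}=0$ and $\alpha_1^0-\alpha_2^0=\pm2\alpha_3$; • generic type (Bra) (invariants $k_1,k_2$): $N^{\mathrm{mon}}=0$ and $\alpha_1^0-\alpha_2^0=\pm\frac{-k_2}{k_1+k_2}$; • generic type (Reg), $N^{\mathrm{mon}}=0$ (invariants $k_1,\alpha_4$): $\alpha_1^0-\alpha_2^0=\pm\alpha_4$; • generic type (Reg), $N^{\mathrm{mon}}\ne0$ (invariants $\widetilde k_1,\alpha_4$): $\alpha_1^0-\alpha_2^0=|\alpha_4|$; • generic type (Log) (invariant $k_1$): $N^{\mathrm{mon}}=0$ and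 $\alpha_1^0-\alpha_2^0=\pm1$.
   Context: A $(TE)$-structure over a complex manifold $M$ (or a germ) is a holomorphic vector bundle $H\to\mathbb C\times M$ ($z$ the coordinate on $\mathbb C$) with a flat connection $\nabla$ on $H|_{\mathbb C^*\times M}$ such that $\nabla:\mathcal O(H)\to(z^{-1}\mathcal O_{\mathbb C\times M}\cdot\Omega^1_M+z^{-2}\mathcal O_{\mathbb C\times M}\,dz)\otimes\mathcal O(H)$. An unfolding over $(\mathbb C^2,0)$ of a $(TE)$-structure over a point is a $(TE)$-structure over $(\mathbb C^2,0)$ whose restriction over $0$ is isomorphic to the given one. A $(TE)$-structure over a point is logarithmic if $z\nabla_{\partial_z}\mathcal O(H)_0\subset\mathcal O(H)_0$. $N^{\mathrm{mon}}$ is the logarithm of the unipotent part of the monodromy. $C^\alpha$ is the space of global sections $\sigma$ of $H|_{\mathbb C^*}$ with $(\nabla_{z\partial_z}-\alpha)^2\sigma=0$. The leading exponents of a logarithmic rank 2 $(TE)$-structure over a point are the numbers $\alpha_1^0,\alpha_2^0$ with: if $N^{\mathrm{mon}}=0$, $\mathcal O(H)_0=\mathbb C\{z\}s_1\oplus\mathbb C\{z\}s_2$ with $s_j\in C^{\alpha_j^0}\setminus\{0\}$; if $N^{\mathrm{mon}}\ne0$, $\alpha_1^0-\alpha_2^0\in\mathbb N_0$ and $\mathcal O(H)_0=\mathbb C\{z\}s_1\oplus\mathbb C\{z\}s_2$ with $s_1\in C^{\alpha_1^0}\setminus\ker(\nabla_{z\partial_z}-\alpha_1^0)$, $s_2\in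 C^{\alpha_2^0}$, $(\nabla_{z\partial_z}-\alpha_1^0)s_1=z^{\alpha_1^0-\alpha_2^0}s_2$. List of $(TE)$-structures over $(\mathbb C^2,0)$ (coordinates $t_1,t_2$, $\partial_i=\partial/\partial t_i$): given by a basis $\underline v$ near $0$ with $z\nabla_{\partial_i}\underline v=\underline vA_i$, $z^2\nabla_{\partial_z}\underline v=\underline vB$, always $A_1=C_1$, $c_1,\rho^{(1)}\in\mathbb C$. (i) Generic type (Sem): $k_1,k_2\in\mathbb N$, $k_2\ge k_1$, $\zeta\in\mathbb C$ if $k_2-k_1\in2\mathbb N$, $\alpha_3\in\mathbb R_{\ge0}\cup\mathbb H$ if $k_1=k_2$, $\gamma=\frac2{k_1+k_2}$; $A_2=-\gamma^{-1}(t_2^{k_1-1}C_2+t_2^{k_2-1}E)$ if $k_2-k_1>0$ is odd; $A_2=-\gamma^{-1}(t_2^{k_1-1}C_2+\zeta t_2^{(k_1+k_2)/2-1}D+(1-\zeta^2)t_2^{k_2-1}E)$ if $k_2-k_1\in2\mathbb N$; $A_2=-\gamma^{-1}t_2^{k_1-1}D$ if $k_2=k_1$; $B=(-t_1-c_1+z\rho^{(1)})C_1-\gamma t_2A_2+z\beta D$ with $\beta=\frac{k_1-k_2}{2(k_1+k_2)}$ if $k_2>k_1$, $\beta=\alpha_3$ if $k_2=k_1$. (ii) Generic type (Bra): $k_1,k_2\in\mathbb N$, $\gamma=\frac1{k_1+k_2}$; $A_2=-\gamma^{-1}(t_2^{k_1-1}C_2+t_2^{k_1+k_2-1}D-t_2^{k_1+2k_2-1}E)$;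 $B=(-t_1-c_1+z\rho^{(1)})C_1-\gamma t_2A_2+z\frac{-k_2}{2(k_1+k_2)}D$. (iii) Generic type (Reg): $\alpha_4\in\mathbb C\setminus\{-1\}$ and $k_1\in\mathbb N$ if $N^{\mathrm{mon}}=0$; $\alpha_4\in\mathbb Z$ and $\widetilde k_1\in\mathbb N$ if $N^{\mathrm{mon}}\ne0$ (with $k_1=\widetilde k_1$ if $\alpha_4\ne-1$, $k_1=2\widetilde k_1$ if $\alpha_4=-1$); $\gamma=\frac{1+\alpha_4}{k_1}$; $A_2=-\gamma^{-1}t_2^{k_1-1}C_2$ if $N^{\mathrm{mon}}=0$, $A_2=\widetilde k_1t_2^{\widetilde k_1-1}C_2$ if $N^{\mathrm{mon}}\ne0$; $B=(-t_1-c_1+z\rho^{(1)})C_1-\gamma t_2A_2+z\frac12\alpha_4D+R$ with $R=0$ if $N^{\mathrm{mon}}=0$; $R=z^{\alpha_4+1}C_2$ if $N^{\mathrm{mon}}\ne0$, $\alpha_4\in\mathbb N_0$; $R=-z^{-\alpha_4-1}t_2^{2\widetilde k_1}C_2+z^{-\alpha_4}t_2^{\widetilde k_1}D+z^{-\alpha_4+1}E$ if $N^{\mathrm{mon}}\ne0$, $\alpha_4\in\mathbb Z_{<0}$. (iv) Generic type (Log): $k_1\in\mathbb N$; $A_2=k_1t_2^{k_1-1}C_2$; $B=(-t_1-c_1+z\rho^{(1)})C_1-z\frac12D$. $C_1=\begin{pmatrix}1&0\\0&1\end{pmatrix}$, $C_2=\begin{pmatrix}0&0\\1&0\end{pmatrix}$,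 $D=\begin{pmatrix}1&0\\0&-1\end{pmatrix}$, $E=\begin{pmatrix}0&1\\0&0\end{pmatrix}$; $\mathbb N=\{1,2,\dots\}$, $\mathbb N_0=\mathbb N\cup\{0\}$, $2\mathbb N=\{2,4,\dots\}$, $\mathbb H$ the open upper half plane. *)

theory Defs
  imports "HOL-Analysis.Analysis"
begin

type_synonym cvec = "complex^2"
type_synonym cmat = "complex^2^2"

definition mscale :: "complex \<Rightarrow> cmat \<Rightarrow> cmat" (infixr "\<odot>" 75) where
  "c \<odot> M = (\<chi> i j. c * M $ i $ j)"

definition C1 :: cmat where "C1 = vector [vector [1, 0], vector [0, 1]]"
definition C2 :: cmat where "C2 = vector [vector [0, 0], vector [1, 0]]"
definition Dm :: cmat where "Dm = vector [vector [1, 0], vector [0, -1]]"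
definition Em :: cmat where "Em = vector [vector [0, 1], vector [0, 0]]"

definition mat_holomorphic_on :: "(complex \<Rightarrow> cmat) \<Rightarrow> complex set \<Rightarrow> bool" where
  "mat_holomorphic_on F S \<longleftrightarrow> (\<forall>i j. (\<lambda>z. F z $ i $ j) holomorphic_on S)"

definition mat_deriv :: "(complex \<Rightarrow> cmat) \<Rightarrow> complex \<Rightarrow> cmat" where
  "mat_deriv F z = (\<chi> i j. deriv (\<lambda>w. F w $ i $ j) z)"

text \<open>Holomorphy in three variables on an open set: the total real derivative exists and is
  complex linear.\<close>

definition mat_holomorphic3_on ::
  "(complex \<Rightarrow> complex \<Rightarrow> complex \<Rightarrow> cmat) \<Rightarrow> (complex \<times> complex \<times> complex) set \<Rightarrow> bool" where
  "mat_holomorphic3_on F S \<longleftrightarrow>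
     (\<forall>i j. \<forall>p\<in>S. \<exists>L. ((\<lambda>(z, t1, t2). F z t1 t2 $ i $ j) has_derivative L) (at p) \<and>
        (\<forall>c u v w. L (c * u, c * v, c * w) = c * L (u, v, w)))"


section \<open>Rank 2 (TE)-structures over a point\<close>

text \<open>
  A holomorphic vector bundle on the complex plane is trivial. A rank 2 (TE)-structure over a
  point is given here in a global frame \<open>v\<close> of the bundle by the entire matrix function \<open>B\<close> with
  \<open>z\<^sup>2 \<nabla>\<^sub>\<partial>\<^sub>z v = v B\<close>; flatness is automatic. A section is given by its coefficient function \<open>s\<close>
  with respect to \<open>v\<close>. Sections over the punctured plane carry an irrelevant value at \<open>0\<close>.
\<close>

definition te_point :: "(complex \<Rightarrow> cmat) \<Rightarrow> bool" where
  "te_point B \<longleftrightarrow> mat_holomorphic_on B UNIV"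

text \<open>The operator \<open>\<nabla>\<^sub>z\<^sub>\<partial>\<^sub>z - \<alpha>\<close> on sections, for \<open>z \<noteq> 0\<close>.\<close>

definition nabla_minus :: "(complex \<Rightarrow> cmat) \<Rightarrow> complex \<Rightarrow> (complex \<Rightarrow> cvec) \<Rightarrow> complex \<Rightarrow> cvec" where
  "nabla_minus B \<alpha> s z =
     (\<chi> i. z * deriv (\<lambda>w. s w $ i) z + (B z *v s z) $ i / z - \<alpha> * s z $ i)"

text \<open>Germs at \<open>0\<close> of holomorphic sections, as functions on a punctured neighbourhood which
  extend holomorphically.\<close>

definition O0 :: "(complex \<Rightarrow> cvec) set" where
  "O0 = {s. \<exists>f. (\<forall>i. (\<lambda>z. f z $ i) analytic_on {0}) \<and> (\<forall>\<^sub>F z in at 0. s z = f z)}"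

definition logarithmic :: "(complex \<Rightarrow> cmat) \<Rightarrow> bool" where
  "logarithmic B \<longleftrightarrow> (\<forall>s\<in>O0. nabla_minus B 0 s \<in> O0)"

text \<open>\<open>O(H)\<^sub>0 = \<complex>{z} s\<^sub>1 \<oplus> \<complex>{z} s\<^sub>2\<close>\<close>

definition O0_direct_sum :: "(complex \<Rightarrow> cvec) \<Rightarrow> (complex \<Rightarrow> cvec) \<Rightarrow> bool" where
  "O0_direct_sum s1 s2 \<longleftrightarrow>
     (\<forall>s. s \<in> O0 \<longleftrightarrow>
        (\<exists>g1 g2. g1 analytic_on {0} \<and> g2 analytic_on {0} \<and>
           (\<forall>\<^sub>F z in at 0. s z = g1 z *s s1 z + g2 z *s s2 z))) \<and>
     (\<forall>g1 g2. g1 analytic_on {0} \<longrightarrow> g2 analytic_on {0} \<longrightarrow>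
        (\<forall>\<^sub>F z in at 0. g1 z *s s1 z + g2 z *s s2 z = 0) \<longrightarrow>
        (\<forall>\<^sub>F z in at 0. g1 z = 0 \<and> g2 z = 0))"

definition C_space :: "(complex \<Rightarrow> cmat) \<Rightarrow> complex \<Rightarrow> (complex \<Rightarrow> cvec) set" where
  "C_space B \<alpha> = {s. (\<forall>i. (\<lambda>z. s z $ i) holomorphic_on - {0}) \<and>
     (\<forall>z. z \<noteq> 0 \<longrightarrow> nabla_minus B \<alpha> (nabla_minus B \<alpha> s) z = 0)}"

text \<open>
  A basis of flat sections of the pullback of the bundle along \<open>exp\<close>, the universal covering of
  the punctured plane; \<open>z \<partial>\<^sub>z\<close> pulls back to \<open>\<partial>\<^sub>w\<close> where \<open>z = exp w\<close>. The columns of \<open>\<Phi>\<close> are the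
  flat sections.
\<close>

definition flat_basis :: "(complex \<Rightarrow> cmat) \<Rightarrow> (complex \<Rightarrow> cmat) \<Rightarrow> bool" where
  "flat_basis B \<Phi> \<longleftrightarrow> mat_holomorphic_on \<Phi> UNIV \<and>
     (\<forall>w. invertible (\<Phi> w) \<and> mat_deriv \<Phi> w + exp (- w) \<odot> (B (exp w) ** \<Phi> w) = 0)"

text \<open>Monodromy on the fibre at \<open>z = 1\<close>, expressed in the frame \<open>v\<close>.\<close>

definition monodromy :: "(complex \<Rightarrow> cmat) \<Rightarrow> cmat" where
  "monodromy B = (THE M. \<exists>\<Phi>. flat_basis B \<Phi> \<and> \<Phi> 0 = mat 1 \<and> M = \<Phi> (2 * of_real pi * \<i>))"

definition semisimple_mat :: "cmat \<Rightarrow> bool" where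
  "semisimple_mat S \<longleftrightarrow>
     (\<exists>P \<Lambda> :: cmat. invertible P \<and> S ** P = P ** \<Lambda> \<and> (\<forall>i j. i \<noteq> j \<longrightarrow> \<Lambda> $ i $ j = 0))"

definition unipotent_mat :: "cmat \<Rightarrow> bool" where
  "unipotent_mat U \<longleftrightarrow> (U - mat 1) ** (U - mat 1) = 0"

text \<open>Unipotent factor of the multiplicative Jordan--Chevalley decomposition.\<close>

definition unipotent_part :: "cmat \<Rightarrow> cmat" where
  "unipotent_part M =
     (THE U. \<exists>S. semisimple_mat S \<and> unipotent_mat U \<and> M = S ** U \<and> S ** U = U ** S)"

text \<open>In rank 2 the series \<open>log U = (U - 1) - (U - 1)\<^sup>2/2 + \<dots>\<close> of a unipotent \<open>U\<close> reduces to its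
  first term.\<close>

definition N_mon :: "(complex \<Rightarrow> cmat) \<Rightarrow> cmat" where
  "N_mon B = unipotent_part (monodromy B) - mat 1"

text \<open>In the case \<open>N_mon B = 0\<close> the leading exponents are an unordered pair, so the predicate is
  symmetric in them; in the other case they are ordered.\<close>

definition leading_exponents :: "(complex \<Rightarrow> cmat) \<Rightarrow> complex \<Rightarrow> complex \<Rightarrow> bool" where
  "leading_exponents B \<alpha>1 \<alpha>2 \<longleftrightarrow>
     (if N_mon B = 0 then
        \<exists>s1 s2. s1 \<in> C_space B \<alpha>1 \<and> s2 \<in> C_space B \<alpha>2 \<and>
          (\<exists>z. z \<noteq> 0 \<and> s1 z \<noteq> 0) \<and> (\<exists>z. z \<noteq> 0 \<and> s2 z \<noteq> 0) \<and>
          O0_direct_sum s1 s2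
      else
        \<exists>s1 s2. \<exists>n::nat. \<alpha>1 - \<alpha>2 = of_nat n \<and>
          s1 \<in> C_space B \<alpha>1 \<and> s2 \<in> C_space B \<alpha>2 \<and>
          \<not> (\<forall>z. z \<noteq> 0 \<longrightarrow> nabla_minus B \<alpha>1 s1 z = 0) \<and>
          (\<forall>z. z \<noteq> 0 \<longrightarrow> nabla_minus B \<alpha>1 s1 z = z ^ n *s s2 z) \<and>
          O0_direct_sum s1 s2)"

text \<open>Isomorphism over a point: \<open>\<phi>(v) = v' T\<close>.\<close>

definition te_point_iso :: "(complex \<Rightarrow> cmat) \<Rightarrow> (complex \<Rightarrow> cmat) \<Rightarrow> bool" where
  "te_point_iso B B' \<longleftrightarrow>
     (\<exists>T. mat_holomorphic_on T UNIV \<and>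
        (\<forall>z. invertible (T z) \<and> z\<^sup>2 \<odot> mat_deriv T z + B' z ** T z = T z ** B z))"


section \<open>Rank 2 (TE)-structures over the germ of the plane\<close>

text \<open>
  Connection matrices with respect to a global frame over \<open>\<complex> \<times> V\<close>, \<open>V\<close> a (polydisc) neighbourhood
  of the origin, on which every holomorphic vector bundle is trivial:
  \<open>z \<nabla>\<^sub>i v = v A\<^sub>i(z,t\<^sub>1,t\<^sub>2)\<close> and \<open>z\<^sup>2 \<nabla>\<^sub>\<partial>\<^sub>z v = v B(z,t\<^sub>1,t\<^sub>2)\<close>.
\<close>

record te2 =
  te_A1 :: "complex \<Rightarrow> complex \<Rightarrow> complex \<Rightarrow> cmat"
  te_A2 :: "complex \<Rightarrow> complex \<Rightarrow> complex \<Rightarrow> cmat"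
  te_B :: "complex \<Rightarrow> complex \<Rightarrow> complex \<Rightarrow> cmat"

text \<open>The three equations are the vanishing of the curvature, multiplied by \<open>z\<^sup>2\<close>, respectively
  \<open>z\<^sup>3\<close>.\<close>

definition te_germ :: "te2 \<Rightarrow> bool" where
  "te_germ G \<longleftrightarrow> (\<exists>V. open V \<and> (0, 0) \<in> V \<and>
     mat_holomorphic3_on (te_A1 G) (UNIV \<times> V) \<and>
     mat_holomorphic3_on (te_A2 G) (UNIV \<times> V) \<and>
     mat_holomorphic3_on (te_B G) (UNIV \<times> V) \<and>
     (\<forall>z t1 t2. z \<noteq> 0 \<longrightarrow> (t1, t2) \<in> V \<longrightarrow>
        (let A1 = te_A1 G z t1 t2; A2 = te_A2 G z t1 t2; B = te_B G z t1 t2 in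
           z \<odot> mat_deriv (\<lambda>t. te_A2 G z t t2) t1 - z \<odot> mat_deriv (\<lambda>t. te_A1 G z t1 t) t2
             + (A1 ** A2 - A2 ** A1) = 0 \<and>
           z \<odot> mat_deriv (\<lambda>t. te_B G z t t2) t1 - z\<^sup>2 \<odot> mat_deriv (\<lambda>w. te_A1 G w t1 t2) z
             + z \<odot> A1 + (A1 ** B - B ** A1) = 0 \<and>
           z \<odot> mat_deriv (\<lambda>t. te_B G z t1 t) t2 - z\<^sup>2 \<odot> mat_deriv (\<lambda>w. te_A2 G w t1 t2) z
             + z \<odot> A2 + (A2 ** B - B ** A2) = 0)))"

definition unfolding_of :: "te2 \<Rightarrow> (complex \<Rightarrow> cmat) \<Rightarrow> bool" where
  "unfolding_of G B0 \<longleftrightarrow> te_germ G \<and> te_point_iso (\<lambda>z. te_B G z 0 0) B0"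


section \<open>The list of (TE)-structures over the germ of the plane\<close>

datatype te_type =
    Sem_odd (inv_k1: nat) (inv_k2: nat)
  | Sem_even (inv_k1: nat) (inv_k2: nat) (inv_zeta: complex)
  | Sem_eq (inv_k1: nat) (inv_k2: nat) (inv_alpha3: complex)
  | Bra (inv_k1: nat) (inv_k2: nat)
  | Reg_semisimple (inv_k1: nat) (inv_alpha4: complex)   \<comment> \<open>\<open>N\<^sup>m\<^sup>o\<^sup>n = 0\<close>\<close>
  | Reg_nilpotent (inv_ktilde1: nat) (inv_alpha4_int: int)   \<comment> \<open>\<open>N\<^sup>m\<^sup>o\<^sup>n \<noteq> 0\<close>\<close>
  | Log (inv_k1: nat)

fun admissible :: "te_type \<Rightarrow> bool" where
  "admissible (Sem_odd k1 k2) \<longleftrightarrow> 1 \<le> k1 \<and> k1 < k2 \<and> odd (k2 - k1)"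
| "admissible (Sem_even k1 k2 \<zeta>) \<longleftrightarrow> 1 \<le> k1 \<and> k1 < k2 \<and> even (k2 - k1)"
| "admissible (Sem_eq k1 k2 \<alpha>3) \<longleftrightarrow> 1 \<le> k1 \<and> k2 = k1 \<and> ((Im \<alpha>3 = 0 \<and> 0 \<le> Re \<alpha>3) \<or> 0 < Im \<alpha>3)"
| "admissible (Bra k1 k2) \<longleftrightarrow> 1 \<le> k1 \<and> 1 \<le> k2"
| "admissible (Reg_semisimple k1 \<alpha>4) \<longleftrightarrow> 1 \<le> k1 \<and> \<alpha>4 \<noteq> -1"
| "admissible (Reg_nilpotent kt \<alpha>4) \<longleftrightarrow> 1 \<le> kt"
| "admissible (Log k1) \<longleftrightarrow> 1 \<le> k1"

text \<open>The type \<open>Log\<close> has no term \<open>\<gamma> t\<^sub>2 A\<^sub>2\<close> in \<open>B\<close>; this is encoded by \<open>\<gamma> = 0\<close>.\<close>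

fun te_gamma :: "te_type \<Rightarrow> complex" where
  "te_gamma (Sem_odd k1 k2) = 2 / of_nat (k1 + k2)"
| "te_gamma (Sem_even k1 k2 \<zeta>) = 2 / of_nat (k1 + k2)"
| "te_gamma (Sem_eq k1 k2 \<alpha>3) = 2 / of_nat (k1 + k2)"
| "te_gamma (Bra k1 k2) = 1 / of_nat (k1 + k2)"
| "te_gamma (Reg_semisimple k1 \<alpha>4) = (1 + \<alpha>4) / of_nat k1"
| "te_gamma (Reg_nilpotent kt \<alpha>4) =
     (1 + of_int \<alpha>4) / of_nat (if \<alpha>4 = -1 then 2 * kt else kt)"
| "te_gamma (Log k1) = 0"

fun nf_A2 :: "te_type \<Rightarrow> complex \<Rightarrow> cmat" where
  "nf_A2 (Sem_odd k1 k2) t2 =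
     (- inverse (te_gamma (Sem_odd k1 k2))) \<odot> (t2 ^ (k1 - 1) \<odot> C2 + t2 ^ (k2 - 1) \<odot> Em)"
| "nf_A2 (Sem_even k1 k2 \<zeta>) t2 =
     (- inverse (te_gamma (Sem_even k1 k2 \<zeta>))) \<odot>
       (t2 ^ (k1 - 1) \<odot> C2 + (\<zeta> * t2 ^ ((k1 + k2) div 2 - 1)) \<odot> Dm
         + ((1 - \<zeta>\<^sup>2) * t2 ^ (k2 - 1)) \<odot> Em)"
| "nf_A2 (Sem_eq k1 k2 \<alpha>3) t2 =
     (- inverse (te_gamma (Sem_eq k1 k2 \<alpha>3))) \<odot> (t2 ^ (k1 - 1) \<odot> Dm)"
| "nf_A2 (Bra k1 k2) t2 =
     (- inverse (te_gamma (Bra k1 k2))) \<odot>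
       (t2 ^ (k1 - 1) \<odot> C2 + t2 ^ (k1 + k2 - 1) \<odot> Dm - t2 ^ (k1 + 2 * k2 - 1) \<odot> Em)"
| "nf_A2 (Reg_semisimple k1 \<alpha>4) t2 =
     (- inverse (te_gamma (Reg_semisimple k1 \<alpha>4))) \<odot> (t2 ^ (k1 - 1) \<odot> C2)"
| "nf_A2 (Reg_nilpotent kt \<alpha>4) t2 = (of_nat kt * t2 ^ (kt - 1)) \<odot> C2"
| "nf_A2 (Log k1) t2 = (of_nat k1 * t2 ^ (k1 - 1)) \<odot> C2"

text \<open>The coefficient of \<open>z D\<close> in \<open>B\<close>.\<close>

fun te_beta :: "te_type \<Rightarrow> complex" where
  "te_beta (Sem_odd k1 k2) = (of_nat k1 - of_nat k2) / (2 * of_nat (k1 + k2))"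
| "te_beta (Sem_even k1 k2 \<zeta>) = (of_nat k1 - of_nat k2) / (2 * of_nat (k1 + k2))"
| "te_beta (Sem_eq k1 k2 \<alpha>3) = \<alpha>3"
| "te_beta (Bra k1 k2) = - of_nat k2 / (2 * of_nat (k1 + k2))"
| "te_beta (Reg_semisimple k1 \<alpha>4) = \<alpha>4 / 2"
| "te_beta (Reg_nilpotent kt \<alpha>4) = of_int \<alpha>4 / 2"
| "te_beta (Log k1) = - (1 / 2)"

fun nf_R :: "te_type \<Rightarrow> complex \<Rightarrow> complex \<Rightarrow> cmat" where
  "nf_R (Reg_nilpotent kt \<alpha>4) z t2 =
     (if \<alpha>4 \<ge> 0 then z ^ nat (\<alpha>4 + 1) \<odot> C2
      else (- (z ^ nat (- \<alpha>4 - 1) * t2 ^ (2 * kt))) \<odot> C2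
             + (z ^ nat (- \<alpha>4) * t2 ^ kt) \<odot> Dm
             + z ^ nat (- \<alpha>4 + 1) \<odot> Em)"
| "nf_R _ z t2 = 0"

definition normal_form :: "te_type \<Rightarrow> complex \<Rightarrow> complex \<Rightarrow> te2" where
  "normal_form X c1 \<rho> = \<lparr>
     te_A1 = (\<lambda>z t1 t2. C1),
     te_A2 = (\<lambda>z t1 t2. nf_A2 X t2),
     te_B = (\<lambda>z t1 t2. (- t1 - c1 + z * \<rho>) \<odot> C1 - (te_gamma X * t2) \<odot> nf_A2 X t2
               + (z * te_beta X) \<odot> Dm + nf_R X z t2) \<rparr>"

end

theory Submission
  imports Defs "HOL-Complex_Analysis.Cauchy_Integral_Formula"
begin

text \<open>
  Over the origin every structure of the list restricts to a connection whose matrix is \<open>z\<close> times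
  a triangular matrix with constant diagonal, up to the summand \<open>- c\<^sub>1\<close>. The theorem thus splits
  into three independent facts.

  \<^item> Every member of the list is flat, hence a \<open>(TE)\<close>-structure (\<open>te_germ_normal_form\<close>). All
  members are covered by one computation: with the weight \<open>te_gamma\<close> for \<open>t\<^sub>2\<close> and the weights
  given by the commutator with \<open>Dm\<close>, the matrix \<open>A\<^sub>2\<close> is quasihomogeneous, and the curvature of
  the structure is the Euler identity of \<open>A\<^sub>2\<close> plus a term that involves only the summand \<open>R\<close>.

  \<^item> A logarithmic structure is determined by its leading exponents and by the vanishing of
  \<open>N_mon\<close>: in the frame \<open>s\<^sub>1, s\<^sub>2\<close> of their definition it becomes \<open>log_form \<alpha>1 \<alpha>2 0\<close> if
  \<open>N_mon = 0\<close> and \<open>log_form \<alpha>1 \<alpha>2 (\<lambda>z. z ^ n)\<close> with \<open>n = \<alpha>1 - \<alpha>2\<close> otherwise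
  (\<open>leading_exponents_iso\<close>). In the first case one has to exclude that some \<open>s\<^sub>j\<close> is only a
  generalized eigensection. If \<open>s\<close> is one and \<open>u = (\<nabla> - \<alpha>) s \<noteq> 0\<close>, then \<open>z powr (- \<alpha>) u\<close> and
  \<open>z powr (- \<alpha>) (s - u log z)\<close> form a flat basis on which the monodromy is a Jordan block, so
  that \<open>N_mon \<noteq> 0\<close> (\<open>N_mon_nonzero\<close>).

  \<^item> Two such forms are isomorphic only in the evident cases. A gauge transformation conjugates the
  values at \<open>0\<close> of the matrices divided by \<open>z\<close>, so the unordered pair of exponents is an invariant
  (\<open>log_form_iso_residue\<close>); the semisimple and the nilpotent forms are separated because an
  isomorphism would produce a single-valued logarithm (\<open>log_form_nilpotent_not_semisimple\<close>).

  A gauge transformation to a form that vanishes at \<open>z = 0\<close> forces \<open>c\<^sub>1 = 0\<close>. Restricting a normal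
  form to the origin gives the exponents \<open>\<rho> \<plusminus> \<beta>\<close>, where \<open>\<beta>\<close> is the coefficient \<open>te_beta\<close> of
  \<open>z Dm\<close>; comparing their sum and difference with \<open>\<alpha>1\<close> and \<open>\<alpha>2\<close> yields the conditions of the
  theorem.
\<close>

section \<open>Calculus of holomorphic matrices\<close>

lemma mat2_eq_iff:
  fixes A B :: cmat
  shows "A = B \<longleftrightarrow> A $ 1 $ 1 = B $ 1 $ 1 \<and> A $ 1 $ 2 = B $ 1 $ 2 \<and> A $ 2 $ 1 = B $ 2 $ 1 \<and> A $ 2 $ 2 = B $ 2 $ 2"
  by (auto simp: vec_eq_iff forall_2)

lemma matmul2_nth:
  fixes A B :: cmat
  shows "(A ** B) $ i $ j = A $ i $ 1 * B $ 1 $ j + A $ i $ 2 * B $ 2 $ j"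
  by (simp add: matrix_matrix_mult_def sum_2)

lemma matvec2_nth:
  fixes A :: cmat and x :: cvec
  shows "(A *v x) $ i = A $ i $ 1 * x $ 1 + A $ i $ 2 * x $ 2"
  by (simp add: matrix_vector_mult_def sum_2)

lemma mscale_nth: "(c \<odot> M) $ i $ j = c * M $ i $ j"
  by (simp add: mscale_def)

lemma mat2_nth:
  "(mat c :: cmat) $ 1 $ 1 = c" "(mat c :: cmat) $ 1 $ 2 = 0"
  "(mat c :: cmat) $ 2 $ 1 = 0" "(mat c :: cmat) $ 2 $ 2 = c"
  by (simp_all add: mat_def)

lemmas mat2_entries = mat2_eq_iff matmul2_nth mscale_nth mat2_nth

lemma mscale_left: "(c \<odot> A) ** B = c \<odot> (A ** B)"
  and mscale_right: "A ** (c \<odot> B) = c \<odot> (A ** B)"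
  and mscale_add: "c \<odot> (A + B) = c \<odot> A + c \<odot> B"
  and mscale_minus: "c \<odot> (- A) = - (c \<odot> A)"
  by (simp_all add: mat2_entries algebra_simps)

lemma matmul_minus_left: "(- A) ** B = - (A ** (B :: cmat))"
  and matmul_minus_right: "A ** (- B) = - (A ** (B :: cmat))"
  and matmul_add_left: "(A + C) ** B = A ** (B :: cmat) + C ** B"
  and matmul_diff_left: "(A - C) ** B = A ** (B :: cmat) - C ** B"
  and matmul_diff_right: "B ** (A - C) = B ** (A :: cmat) - B ** C"
  by (simp_all add: mat2_entries algebra_simps)

text \<open>
  A relation rather than an equation for \<open>mat_deriv\<close>, so that differentiability is carried along
  and the product rules have no side conditions.
\<close>

definition has_mderiv :: "(complex \<Rightarrow> cmat) \<Rightarrow> cmat \<Rightarrow> complex \<Rightarrow> bool" where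
  "has_mderiv F F' z \<longleftrightarrow> (\<forall>i j. ((\<lambda>w. F w $ i $ j) has_field_derivative F' $ i $ j) (at z))"

lemma has_mderivD:
  "has_mderiv F F' z \<Longrightarrow> ((\<lambda>w. F w $ i $ j) has_field_derivative F' $ i $ j) (at z)"
  by (simp add: has_mderiv_def)

lemma has_mderiv_imp_mat_deriv: "has_mderiv F F' z \<Longrightarrow> mat_deriv F z = F'"
  by (simp add: has_mderiv_def mat_deriv_def vec_eq_iff DERIV_imp_deriv)

lemma has_mderiv_unique: "has_mderiv F F' z \<Longrightarrow> has_mderiv F F'' z \<Longrightarrow> F' = F''"
  using has_mderiv_imp_mat_deriv by blast

lemma mat_holomorphic_on_has_mderiv:
  assumes "mat_holomorphic_on F S" "open S" "z \<in> S"
  shows "has_mderiv F (mat_deriv F z) z"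
  unfolding has_mderiv_def
proof (intro allI)
  fix i j :: 2
  have "(\<lambda>w. F w $ i $ j) holomorphic_on S"
    using assms(1) by (simp add: mat_holomorphic_on_def)
  then show "((\<lambda>w. F w $ i $ j) has_field_derivative mat_deriv F z $ i $ j) (at z)"
    unfolding mat_deriv_def vec_lambda_beta by (rule holomorphic_derivI) (use assms in auto)
qed

lemma has_mderiv_imp_mat_holomorphic_on:
  assumes "\<And>z. z \<in> S \<Longrightarrow> has_mderiv F (F' z) z"
  shows "mat_holomorphic_on F S"
  unfolding mat_holomorphic_on_def
proof (intro allI)
  fix i j :: 2
  show "(\<lambda>z. F z $ i $ j) holomorphic_on S"
    using has_mderivD[OF assms] field_differentiable_at_within
    unfolding holomorphic_on_def field_differentiable_def by (meson has_field_derivative_at_within)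
qed

lemma has_mderiv_const: "has_mderiv (\<lambda>w. M) 0 z"
  by (simp add: has_mderiv_def)

lemma has_mderiv_add:
  "has_mderiv F F' z \<Longrightarrow> has_mderiv G G' z \<Longrightarrow> has_mderiv (\<lambda>w. F w + G w) (F' + G') z"
  and has_mderiv_diff:
  "has_mderiv F F' z \<Longrightarrow> has_mderiv G G' z \<Longrightarrow> has_mderiv (\<lambda>w. F w - G w) (F' - G') z"
  by (auto simp: has_mderiv_def intro!: derivative_intros)

lemma has_mderiv_mscale:
  assumes "(f has_field_derivative f') (at z)" "has_mderiv F F' z"
  shows "has_mderiv (\<lambda>w. f w \<odot> F w) (f' \<odot> F z + f z \<odot> F') z"
  unfolding has_mderiv_def
proof (intro allI)
  fix i j :: 2
  show "((\<lambda>w. (f w \<odot> F w) $ i $ j) has_field_derivative (f' \<odot> F z + f z \<odot> F') $ i $ j) (at z)"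
    using DERIV_mult[OF assms(1) has_mderivD[OF assms(2), of i j]]
    by (simp add: mscale_nth mult.commute)
qed

lemma has_mderiv_matmul:
  assumes "has_mderiv F F' z" "has_mderiv G G' z"
  shows "has_mderiv (\<lambda>w. F w ** G w) (F' ** G z + F z ** G') z"
  unfolding has_mderiv_def matmul2_nth vector_add_component
  by (auto intro!: derivative_eq_intros has_mderivD[OF assms(1)] has_mderivD[OF assms(2)]
      simp: algebra_simps)

definition adj2 :: "cmat \<Rightarrow> cmat" where
  "adj2 A = vector [vector [A $ 2 $ 2, - A $ 1 $ 2], vector [- A $ 2 $ 1, A $ 1 $ 1]]"

lemma adj2_mult: "A ** adj2 A = mat (det A)" "adj2 A ** A = mat (det A)"
  by (simp_all add: mat2_entries adj2_def det_2 algebra_simps)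

text \<open>
  The inverse as a rational expression in the entries, which makes its differentiability evident.
\<close>

definition inv2 :: "cmat \<Rightarrow> cmat" where
  "inv2 A = (1 / det A) \<odot> adj2 A"

lemma inv2_right: "invertible A \<Longrightarrow> A ** inv2 A = mat 1"
  and inv2_left: "invertible A \<Longrightarrow> inv2 A ** A = mat 1"
  unfolding inv2_def mscale_left mscale_right adj2_mult invertible_det_nz
  by (simp_all add: mat2_entries)

text \<open>
  The explicit inverse is used only to see that a derivative exists; its value then follows by
  differentiating \<open>F w ** inv2 (F w) = mat 1\<close>.
\<close>

lemma has_mderiv_inv:
  assumes F: "has_mderiv F F' z" and inv: "\<And>w. invertible (F w)"
  shows "has_mderiv (\<lambda>w. inv2 (F w)) (- (inv2 (F z) ** F' ** inv2 (F z))) z"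
proof -
  let ?V = "\<lambda>w. inv2 (F w)"
  have nz: "det (F w) \<noteq> 0" for w
    using inv[of w] by (simp add: invertible_det_nz)
  have "\<exists>V'. has_mderiv (\<lambda>w. (1 / det (F w)) \<odot> adj2 (F w)) V' z"
  proof -
    have "has_mderiv (\<lambda>w. adj2 (F w)) (adj2 F') z"
      by (auto simp: has_mderiv_def forall_2 adj2_def intro!: DERIV_minus has_mderivD[OF F])
    moreover have "\<exists>d'. ((\<lambda>w. 1 / det (F w)) has_field_derivative d') (at z)"
      using nz[of z] has_mderivD[OF F] unfolding det_2
      by (auto intro!: exI derivative_eq_intros)
    ultimately show ?thesis
      using has_mderiv_mscale by blast
  qed
  then obtain V' where V': "has_mderiv ?V V' z"
    unfolding inv2_def by blast
  have "has_mderiv (\<lambda>w. F w ** ?V w) (F' ** ?V z + F z ** V') z"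
    by (rule has_mderiv_matmul[OF F V'])
  then have "F' ** ?V z + F z ** V' = 0"
    using has_mderiv_const[of "mat 1" z] unfolding inv2_right[OF inv] by (rule has_mderiv_unique)
  then have "?V z ** (F' ** ?V z) + ?V z ** (F z ** V') = 0"
    by (metis matrix_add_ldistrib times0_right)
  then have "?V z ** F' ** ?V z + V' = 0"
    by (simp add: matrix_mul_assoc inv2_left[OF inv])
  then have "V' = - (?V z ** F' ** ?V z)"
    by (simp add: eq_neg_iff_add_eq_0 add.commute)
  with V' show ?thesis by simp
qed


section \<open>Isomorphism over a point is an equivalence relation\<close>

lemma te_point_isoI:
  assumes "\<And>z. has_mderiv T (T' z) z" "\<And>z. invertible (T z)"
    "\<And>z. z\<^sup>2 \<odot> T' z + B' z ** T z = T z ** B z"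
  shows "te_point_iso B B'"
  unfolding te_point_iso_def
  using assms has_mderiv_imp_mat_holomorphic_on[of UNIV T T'] has_mderiv_imp_mat_deriv by metis

lemma te_point_isoE:
  assumes "te_point_iso B B'"
  obtains T T' where "mat_holomorphic_on T UNIV" "\<And>z. has_mderiv T (T' z) z"
    "\<And>z. invertible (T z)" "\<And>z. z\<^sup>2 \<odot> T' z + B' z ** T z = T z ** B z"
proof -
  obtain T where T: "mat_holomorphic_on T UNIV"
    "\<And>z. invertible (T z)" "\<And>z. z\<^sup>2 \<odot> mat_deriv T z + B' z ** T z = T z ** B z"
    using assms unfolding te_point_iso_def by auto
  show thesis
    by (rule that[of T "mat_deriv T"]) (use T mat_holomorphic_on_has_mderiv in auto)
qed

lemma te_point_iso_trans:
  assumes "te_point_iso B B'" "te_point_iso B' B''"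
  shows "te_point_iso B B''"
proof -
  obtain T T' where T: "\<And>z. has_mderiv T (T' z) z" "\<And>z. invertible (T z)"
    and eqT: "\<And>z. z\<^sup>2 \<odot> T' z + B' z ** T z = T z ** B z"
    using te_point_isoE[OF assms(1)] by metis
  obtain U U' where U: "\<And>z. has_mderiv U (U' z) z" "\<And>z. invertible (U z)"
    and eqU: "\<And>z. z\<^sup>2 \<odot> U' z + B'' z ** U z = U z ** B' z"
    using te_point_isoE[OF assms(2)] by metis
  show ?thesis
  proof (rule te_point_isoI)
    fix z
    show "has_mderiv (\<lambda>z. U z ** T z) (U' z ** T z + U z ** T' z) z"
      by (rule has_mderiv_matmul[OF U(1) T(1)])
    show "invertible (U z ** T z)"
      by (rule invertible_mult[OF U(2) T(2)])
    have "z\<^sup>2 \<odot> (U' z ** T z + U z ** T' z) + B'' z ** (U z ** T z)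
        = (z\<^sup>2 \<odot> U' z + B'' z ** U z) ** T z + U z ** (z\<^sup>2 \<odot> T' z)"
      by (simp add: mscale_add mscale_left mscale_right matmul_add_left matrix_mul_assoc
          algebra_simps)
    also have "\<dots> = U z ** (z\<^sup>2 \<odot> T' z + B' z ** T z)"
      unfolding eqU by (simp add: matrix_add_ldistrib matrix_mul_assoc algebra_simps)
    also have "\<dots> = U z ** T z ** B z"
      by (simp add: eqT matrix_mul_assoc)
    finally show "z\<^sup>2 \<odot> (U' z ** T z + U z ** T' z) + B'' z ** (U z ** T z) = U z ** T z ** B z" .
  qed
qed

lemma te_point_iso_sym:
  assumes "te_point_iso B B'"
  shows "te_point_iso B' B"
proof -
  obtain T T' where T: "\<And>z. has_mderiv T (T' z) z" and inv: "\<And>z. invertible (T z)"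
    and eqT: "\<And>z. z\<^sup>2 \<odot> T' z + B' z ** T z = T z ** B z"
    using te_point_isoE[OF assms(1)] by metis
  define V where "V z = inv2 (T z)" for z
  have VT: "V z ** T z = mat 1" "T z ** V z = mat 1" for z
    using inv by (simp_all add: V_def inv2_left inv2_right)
  show ?thesis
  proof (rule te_point_isoI)
    fix z
    show "has_mderiv V (- (V z ** T' z ** V z)) z"
      unfolding V_def by (rule has_mderiv_inv[OF T inv])
    show "invertible (V z)"
      using VT invertible_def by blast
    have e: "z\<^sup>2 \<odot> T' z = T z ** B z - B' z ** T z"
      using eqT[of z] by (simp add: algebra_simps)
    have "z\<^sup>2 \<odot> (- (V z ** T' z ** V z)) = - (V z ** (z\<^sup>2 \<odot> T' z) ** V z)"
      by (simp add: mscale_minus mscale_left mscale_right)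
    also have "\<dots> = V z ** B' z ** (T z ** V z) - (V z ** T z) ** B z ** V z"
      by (simp add: e matmul_diff_left matmul_diff_right matrix_mul_assoc)
    also have "\<dots> = V z ** B' z - B z ** V z"
      by (simp add: VT)
    finally show "z\<^sup>2 \<odot> (- (V z ** T' z ** V z)) + B z ** V z = V z ** B' z"
      by simp
  qed
qed


section \<open>Holomorphic linear differential systems\<close>

lemma higher_deriv_mult_eq_0:
  assumes "f holomorphic_on U" "y holomorphic_on U" "open U" "w \<in> U"
    and "\<And>k. k \<le> n \<Longrightarrow> (deriv ^^ k) y w = 0"
  shows "(deriv ^^ n) (\<lambda>z. f z * y z) w = 0"
  using assms by (subst higher_deriv_mult[of f U]) auto

text \<open>
  Differentiating the system repeatedly shows that all derivatives of a solution with initial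
  value zero vanish at the initial point; the identity theorem does the rest.
\<close>

lemma linear_system_unique:
  assumes U: "open U" "connected U"
    and hol: "a holomorphic_on U" "b holomorphic_on U" "c holomorphic_on U" "d holomorphic_on U"
    and y1: "\<And>z. z \<in> U \<Longrightarrow> (y1 has_field_derivative a z * y1 z + b z * y2 z) (at z)"
    and y2: "\<And>z. z \<in> U \<Longrightarrow> (y2 has_field_derivative c z * y1 z + d z * y2 z) (at z)"
    and w: "w \<in> U" "y1 w = 0" "y2 w = 0"
    and z: "z \<in> U"
  shows "y1 z = 0" "y2 z = 0"
proof -
  have hy: "y1 holomorphic_on U" "y2 holomorphic_on U"
    using y1 y2 U(1) holomorphic_on_open by blast+
  have "(deriv ^^ n) y1 w = 0 \<and> (deriv ^^ n) y2 w = 0" for n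
  proof (induction n rule: less_induct)
    case (less n)
    show ?case
    proof (cases n)
      case 0
      with w show ?thesis by simp
    next
      case (Suc m)
      have m: "(deriv ^^ k) y1 w = 0" "(deriv ^^ k) y2 w = 0" if "k \<le> m" for k
        using less.IH[of k] that Suc by auto
      have step: "(deriv ^^ n) y w = 0"
        if hy': "y holomorphic_on U" and pq: "p holomorphic_on U" "q holomorphic_on U"
          and d: "\<And>z. z \<in> U \<Longrightarrow> (y has_field_derivative p z * y1 z + q z * y2 z) (at z)"
        for y p q
      proof -
        have "(deriv ^^ n) y w = (deriv ^^ m) (deriv y) w"
          by (simp add: Suc funpow_swap1)
        also have "\<dots> = (deriv ^^ m) (\<lambda>z. p z * y1 z + q z * y2 z) w"
          by (rule higher_deriv_transform_within_open[of _ U])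
            (auto intro!: holomorphic_intros hy hy' pq holomorphic_deriv U w DERIV_imp_deriv d)
        also have "\<dots> = (deriv ^^ m) (\<lambda>z. p z * y1 z) w + (deriv ^^ m) (\<lambda>z. q z * y2 z) w"
          by (rule higher_deriv_add[of _ U]) (auto intro!: holomorphic_intros hy pq U w)
        also have "\<dots> = 0"
          using higher_deriv_mult_eq_0[OF pq(1) hy(1) U(1) w(1) m(1)]
            higher_deriv_mult_eq_0[OF pq(2) hy(2) U(1) w(1) m(2)] by simp
        finally show ?thesis .
      qed
      show ?thesis
        using step[OF hy(1) hol(1,2) y1] step[OF hy(2) hol(3,4) y2] by blast
    qed
  qed
  then show "y1 z = 0" "y2 z = 0"
    using holomorphic_fun_eq_0_on_connected[OF hy(1) U _ w(1) z]
      holomorphic_fun_eq_0_on_connected[OF hy(2) U _ w(1) z] by blast+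
qed

lemma linear_equation_unique:
  assumes "open U" "connected U" "q holomorphic_on U"
    and "\<And>z. z \<in> U \<Longrightarrow> (y has_field_derivative q z * y z) (at z)"
    and "w \<in> U" "y w = 0" "z \<in> U"
  shows "y z = 0"
  by (rule linear_system_unique(1)[of U q "\<lambda>_. 0" "\<lambda>_. 0" "\<lambda>_. 0" y "\<lambda>_. 0" w z])
    (use assms in auto)

lemma punctured_plane: "open (- {0 :: complex})" "connected (- {0 :: complex})"
  by (auto intro: connected_punctured_universe)


section \<open>Gauge transformations to a logarithmic normal form\<close>

lemma entire_isCont: "f holomorphic_on UNIV \<Longrightarrow> isCont f (z :: complex)"
  by (metis UNIV_I field_differentiable_imp_continuous_at holomorphic_on_imp_differentiable_at open_UNIV)

lemma isCont_eventually_const: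
  fixes f :: "complex \<Rightarrow> complex"
  assumes "isCont f x" "\<forall>\<^sub>F z in at x. f z = c"
  shows "f x = c"
proof (rule tendsto_unique)
  show "(f \<longlongrightarrow> f x) (at x)"
    using assms(1) by (simp add: isCont_def)
  show "(f \<longlongrightarrow> c) (at x)"
    using assms(2) by (rule tendsto_eventually)
qed simp

lemma isCont_eq_at_0:
  fixes f g :: "complex \<Rightarrow> complex"
  assumes "isCont f 0" "isCont g 0" "\<And>z. z \<noteq> 0 \<Longrightarrow> f z = g z"
  shows "f 0 = g 0"
  using isCont_eventually_const[of 0 "\<lambda>z. f z - g z" 0] assms
  by (simp add: eventually_at_filter)

text \<open>
  Liouville's formula: the determinant of a gauge transformation solves a scalar equation whose
  coefficient is the difference of the traces. It therefore vanishes everywhere on the punctured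
  plane or nowhere.
\<close>

lemma det_gauge:
  assumes "has_mderiv T T' z" "z \<noteq> 0" "z\<^sup>2 \<odot> T' + B' ** T z = T z ** B"
  shows "((\<lambda>w. det (T w)) has_field_derivative
    (B $ 1 $ 1 + B $ 2 $ 2 - B' $ 1 $ 1 - B' $ 2 $ 2) / z\<^sup>2 * det (T z)) (at z)"
proof -
  let ?d = "T' $ 1 $ 1 * T z $ 2 $ 2 + T z $ 1 $ 1 * T' $ 2 $ 2
    - (T' $ 1 $ 2 * T z $ 2 $ 1 + T z $ 1 $ 2 * T' $ 2 $ 1)"
  have eq: "z\<^sup>2 * T' $ i $ j = (T z ** B) $ i $ j - (B' ** T z) $ i $ j" for i j
    using assms(3) by (auto simp: vec_eq_iff mscale_nth algebra_simps)
  have "z\<^sup>2 * ?d = (z\<^sup>2 * T' $ 1 $ 1) * T z $ 2 $ 2 + T z $ 1 $ 1 * (z\<^sup>2 * T' $ 2 $ 2)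
    - ((z\<^sup>2 * T' $ 1 $ 2) * T z $ 2 $ 1 + T z $ 1 $ 2 * (z\<^sup>2 * T' $ 2 $ 1))"
    by (simp add: algebra_simps)
  also have "\<dots> = (B $ 1 $ 1 + B $ 2 $ 2 - B' $ 1 $ 1 - B' $ 2 $ 2) * det (T z)"
    unfolding eq matmul2_nth det_2 by (simp add: algebra_simps)
  finally have "?d = (B $ 1 $ 1 + B $ 2 $ 2 - B' $ 1 $ 1 - B' $ 2 $ 2) / z\<^sup>2 * det (T z)"
    using assms(2) by (simp add: field_simps)
  moreover have "((\<lambda>w. det (T w)) has_field_derivative ?d) (at z)"
    unfolding det_2
    by (auto intro!: derivative_eq_intros has_mderivD[OF assms(1)] simp: algebra_simps)
  ultimately show ?thesis by simp
qed

text \<open>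
  The connection matrix in a frame \<open>s\<^sub>1, s\<^sub>2\<close> with \<open>(\<nabla> - a) s\<^sub>1 = r s\<^sub>2\<close> and
  \<open>(\<nabla> - b) s\<^sub>2 = 0\<close>, where \<open>\<nabla>\<close> stands for the covariant derivative along \<open>z \<partial>\<^sub>z\<close>.
\<close>

definition log_form :: "complex \<Rightarrow> complex \<Rightarrow> (complex \<Rightarrow> complex) \<Rightarrow> complex \<Rightarrow> cmat" where
  "log_form a b r z = vector [vector [z * a, 0], vector [z * r z, z * b]]"

lemma log_form_nth [simp]:
  "log_form a b r z $ 1 $ 1 = z * a" "log_form a b r z $ 1 $ 2 = 0"
  "log_form a b r z $ 2 $ 1 = z * r z" "log_form a b r z $ 2 $ 2 = z * b"
  by (simp_all add: log_form_def)

text \<open>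
  Since the two sections generate the constant sections over the holomorphic germs, their
  coefficient matrix has a holomorphic right inverse near \<open>0\<close>. The product of the two determinants
  is \<open>1\<close> off the origin, hence also at the origin, where \<open>T\<close> is therefore invertible.
\<close>

lemma O0_direct_sum_extension:
  assumes ds: "O0_direct_sum s1 s2"
    and hol: "\<And>i. (\<lambda>z. s1 z $ i) holomorphic_on - {0}" "\<And>i. (\<lambda>z. s2 z $ i) holomorphic_on - {0}"
  obtains T where "mat_holomorphic_on T UNIV" "det (T 0) \<noteq> 0"
    "\<And>z i. z \<noteq> 0 \<Longrightarrow> T z $ i $ 1 = s1 z $ i" "\<And>z i. z \<noteq> 0 \<Longrightarrow> T z $ i $ 2 = s2 z $ i"
proof -
  have span: "s \<in> O0 \<longleftrightarrow> (\<exists>g1 g2. g1 analytic_on {0} \<and> g2 analytic_on {0} \<and>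
      (\<forall>\<^sub>F z in at 0. s z = g1 z *s s1 z + g2 z *s s2 z))" for s
    using ds unfolding O0_direct_sum_def by blast
  have "s1 \<in> O0"
    unfolding span by (rule exI[of _ "\<lambda>_. 1"], rule exI[of _ "\<lambda>_. 0"]) (auto simp: vec_eq_iff)
  then obtain f1 where f1: "\<And>i. (\<lambda>z. f1 z $ i) analytic_on {0}" "\<forall>\<^sub>F z in at 0. s1 z = f1 z"
    unfolding O0_def by auto
  have "s2 \<in> O0"
    unfolding span by (rule exI[of _ "\<lambda>_. 0"], rule exI[of _ "\<lambda>_. 1"]) (auto simp: vec_eq_iff)
  then obtain f2 where f2: "\<And>i. (\<lambda>z. f2 z $ i) analytic_on {0}" "\<forall>\<^sub>F z in at 0. s2 z = f2 z"
    unfolding O0_def by auto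
  have const: "(\<lambda>z. e) \<in> O0" for e
    unfolding O0_def by (auto intro!: exI[of _ "\<lambda>z. e"])
  obtain g1 g2 where g: "g1 analytic_on {0}" "g2 analytic_on {0}"
    "\<forall>\<^sub>F z in at 0. vector [1, 0] = g1 z *s s1 z + g2 z *s s2 z"
    using const[of "vector [1, 0]"] unfolding span by auto
  obtain h1 h2 where h: "h1 analytic_on {0}" "h2 analytic_on {0}"
    "\<forall>\<^sub>F z in at 0. vector [0, 1] = h1 z *s s1 z + h2 z *s s2 z"
    using const[of "vector [0, 1]"] unfolding span by auto
  define T :: "complex \<Rightarrow> cmat" where
    "T z = (\<chi> i j. if j = 1 then (if z = 0 then f1 0 $ i else s1 z $ i)
      else (if z = 0 then f2 0 $ i else s2 z $ i))" for z
  have extend: "(\<lambda>z. if z = 0 then f 0 $ i else s z $ i) holomorphic_on UNIV"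
    if s: "(\<lambda>z. s z $ i) holomorphic_on - {0}" and f: "(\<lambda>z. f z $ i) analytic_on {0}"
      and sf: "\<forall>\<^sub>F z in at 0. s z = f z"
    for s f :: "complex \<Rightarrow> cvec" and i
  proof -
    obtain U where U: "open U" "0 \<in> U" "(\<lambda>z. f z $ i) holomorphic_on U"
      using f unfolding analytic_at by blast
    obtain V where V: "open V" "0 \<in> V" "\<And>z. z \<in> V \<Longrightarrow> z \<noteq> 0 \<Longrightarrow> s z = f z"
      using sf unfolding eventually_at_topological by blast
    have "(\<lambda>z. if z = 0 then f 0 $ i else s z $ i) holomorphic_on U \<inter> V"
      by (rule holomorphic_transform[of "\<lambda>z. f z $ i"])
        (use U V in \<open>auto intro: holomorphic_on_subset\<close>)
    then have "(\<lambda>z. if z = 0 then f 0 $ i else s z $ i) analytic_on {0}"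
      unfolding analytic_at using U V by blast
    moreover have "(\<lambda>z. if z = 0 then f 0 $ i else s z $ i) holomorphic_on - {0}"
      by (rule holomorphic_transform[OF s]) auto
    ultimately have "(\<lambda>z. if z = 0 then f 0 $ i else s z $ i) analytic_on ({0} \<union> - {0})"
      unfolding analytic_on_Un using analytic_on_open[of "- {0}"] by blast
    then show ?thesis
      by (simp add: analytic_on_open)
  qed
  have T: "mat_holomorphic_on T UNIV"
    using extend[OF hol(1) f1] extend[OF hol(2) f2]
    by (simp add: mat_holomorphic_on_def T_def forall_2)
  then have contT: "isCont (\<lambda>z. T z $ i $ j) 0" for i j
    by (intro entire_isCont) (simp add: mat_holomorphic_on_def)
  have contg: "isCont g1 0" "isCont g2 0" "isCont h1 0" "isCont h2 0"
    using g h by (auto intro: analytic_at_imp_isCont)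
  let ?p = "\<lambda>z. det (T z) * (g1 z * h2 z - g2 z * h1 z)"
  have "\<forall>\<^sub>F z in at 0. ?p z = 1"
    using g(3) h(3) eventually_neq_at_within[of 0]
  proof eventually_elim
    case (elim z)
    have T_nth: "T z $ i $ 1 = s1 z $ i" "T z $ i $ 2 = s2 z $ i" for i
      using elim(3) by (simp_all add: T_def)
    let ?G = "vector [vector [g1 z, h1 z], vector [g2 z, h2 z]] :: cmat"
    have "T z ** ?G = mat 1"
      using elim(1,2) by (simp add: vec_eq_iff forall_2 matmul2_nth T_nth mat2_nth mult.commute)
    then have "det (T z) * det ?G = 1"
      by (metis det_I det_mul)
    then show ?case
      by (simp add: det_2[of ?G] mult.commute)
  qed
  moreover have "isCont ?p 0"
    unfolding det_2 by (intro continuous_intros contT contg)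
  ultimately have "?p 0 = 1"
    by (intro isCont_eventually_const)
  then have "det (T 0) \<noteq> 0" by auto
  then show thesis
    by (intro that[of T] T) (auto simp: T_def)
qed

text \<open>
  The coefficient matrix of the frame is the isomorphism. It is invertible at \<open>0\<close> because the
  frame generates the germs of sections, and at all other points by Liouville's formula.
\<close>

lemma te_point_iso_log_form:
  assumes H: "te_point H" and r: "r holomorphic_on UNIV"
    and hol: "\<And>i. (\<lambda>z. s1 z $ i) holomorphic_on - {0}" "\<And>i. (\<lambda>z. s2 z $ i) holomorphic_on - {0}"
    and s1: "\<And>z. z \<noteq> 0 \<Longrightarrow> nabla_minus H a s1 z = r z *s s2 z"
    and s2: "\<And>z. z \<noteq> 0 \<Longrightarrow> nabla_minus H b s2 z = 0"
    and ds: "O0_direct_sum s1 s2"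
  shows "te_point_iso (log_form a b r) H"
proof -
  obtain T where T: "mat_holomorphic_on T UNIV" and T0: "det (T 0) \<noteq> 0"
    and Ts: "\<And>z i. z \<noteq> 0 \<Longrightarrow> T z $ i $ 1 = s1 z $ i" "\<And>z i. z \<noteq> 0 \<Longrightarrow> T z $ i $ 2 = s2 z $ i"
    using O0_direct_sum_extension[OF ds hol] by metis
  have T': "has_mderiv T (mat_deriv T z) z" for z
    using T by (rule mat_holomorphic_on_has_mderiv) auto
  have dT: "mat_deriv T z $ i $ 1 = deriv (\<lambda>w. s1 w $ i) z"
    "mat_deriv T z $ i $ 2 = deriv (\<lambda>w. s2 w $ i) z" if "z \<noteq> 0" for z i
  proof -
    have "\<forall>\<^sub>F w in nhds z. w \<in> - {0}"
      using that by (intro eventually_nhds_in_open) auto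
    then have ev: "\<forall>\<^sub>F w in nhds z. T w $ i $ 1 = s1 w $ i" "\<forall>\<^sub>F w in nhds z. T w $ i $ 2 = s2 w $ i"
      by (auto elim!: eventually_mono simp: Ts)
    show "mat_deriv T z $ i $ 1 = deriv (\<lambda>w. s1 w $ i) z"
      "mat_deriv T z $ i $ 2 = deriv (\<lambda>w. s2 w $ i) z"
      using deriv_cong_ev[OF ev(1)] deriv_cong_ev[OF ev(2)] by (simp_all add: mat_deriv_def)
  qed
  let ?L = "log_form a b r"
  have eq: "z\<^sup>2 \<odot> mat_deriv T z + H z ** T z = T z ** ?L z" if z: "z \<noteq> 0" for z
  proof -
    have "(z\<^sup>2 \<odot> mat_deriv T z + H z ** T z) $ i $ 1 = (T z ** ?L z) $ i $ 1" for i
      using arg_cong[OF s1[OF z], of "\<lambda>v. z * v $ i"] z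
      by (simp add: nabla_minus_def mscale_nth matmul2_nth matvec2_nth dT Ts power2_eq_square
          algebra_simps add_divide_distrib)
    moreover have "(z\<^sup>2 \<odot> mat_deriv T z + H z ** T z) $ i $ 2 = (T z ** ?L z) $ i $ 2" for i
      using arg_cong[OF s2[OF z], of "\<lambda>v. z * v $ i"] z
      by (simp add: nabla_minus_def mscale_nth matmul2_nth matvec2_nth dT Ts power2_eq_square
          algebra_simps add_divide_distrib)
    ultimately show ?thesis
      by (simp only: vec_eq_iff forall_2)
  qed
  have ent: "(\<lambda>z. T z $ i $ j) holomorphic_on UNIV" "(\<lambda>z. H z $ i $ j) holomorphic_on UNIV" for i j
    using T H by (auto simp: mat_holomorphic_on_def te_point_def)
  have ent': "(\<lambda>z. mat_deriv T z $ i $ j) holomorphic_on UNIV" for i j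
    unfolding mat_deriv_def vec_lambda_beta by (intro holomorphic_deriv ent) auto
  have entL: "(\<lambda>z. ?L z $ i $ j) holomorphic_on UNIV" for i j
    using exhaust_2[of i] exhaust_2[of j] by (auto intro!: holomorphic_intros r)
  have "(0\<^sup>2 \<odot> mat_deriv T 0 + H 0 ** T 0) $ i $ j = (T 0 ** ?L 0) $ i $ j" for i j
  proof (rule isCont_eq_at_0[where f = "\<lambda>z. (z\<^sup>2 \<odot> mat_deriv T z + H z ** T z) $ i $ j"
          and g = "\<lambda>z. (T z ** ?L z) $ i $ j"])
    show "isCont (\<lambda>z. (z\<^sup>2 \<odot> mat_deriv T z + H z ** T z) $ i $ j) 0"
      "isCont (\<lambda>z. (T z ** ?L z) $ i $ j) 0"
      unfolding vector_add_component mscale_nth matmul2_nth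
      by (intro entire_isCont holomorphic_intros ent ent' entL)+
  qed (use eq in simp)
  then have eq0: "0\<^sup>2 \<odot> mat_deriv T 0 + H 0 ** T 0 = T 0 ** ?L 0"
    by (simp only: vec_eq_iff) blast
  have "det (T z) \<noteq> 0" for z
  proof
    assume d0: "det (T z) = 0"
    with T0 have z: "z \<in> - {0}" by auto
    let ?q = "\<lambda>z. (z * a + z * b - H z $ 1 $ 1 - H z $ 2 $ 2) / z\<^sup>2"
    have "det (T w) = 0" if "w \<in> - {0}" for w
      by (rule linear_equation_unique[OF punctured_plane, of ?q "\<lambda>w. det (T w)" z w])
        (use z d0 that det_gauge[OF T' _ eq] in
          \<open>auto intro!: holomorphic_intros holomorphic_on_subset[OF ent(2)]\<close>)
    then have "det (T 0) = 0"
      by (intro isCont_eq_at_0[of "\<lambda>w. det (T w)" "\<lambda>_. 0"])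
        (auto simp: det_2[abs_def] intro!: entire_isCont holomorphic_intros ent)
    with T0 show False by simp
  qed
  then have inv: "invertible (T z)" for z
    by (simp add: invertible_det_nz)
  show ?thesis
    by (rule te_point_isoI[OF T' inv]) (use eq eq0 in \<open>metis\<close>)
qed


section \<open>Monodromy\<close>

text \<open>
  A matrix with square zero has vanishing trace and determinant.
\<close>

lemma unipotent_trace_det:
  assumes "unipotent_mat U"
  shows "U $ 1 $ 1 + U $ 2 $ 2 = 2" "det U = 1"
proof -
  define a b c d where X: "a = U $ 1 $ 1 - 1" "b = U $ 1 $ 2" "c = U $ 2 $ 1" "d = U $ 2 $ 2 - 1"
  have sq: "a * a + b * c = 0" "a * b + b * d = 0" "c * a + d * c = 0" "c * b + d * d = 0"
    using assms by (simp_all add: unipotent_mat_def mat2_entries X)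
  have tr: "a + d = 0"
  proof (rule ccontr)
    assume "a + d \<noteq> 0"
    moreover have "b * (a + d) = 0" "c * (a + d) = 0"
      using sq(2,3) by (simp_all add: algebra_simps)
    ultimately have "b = 0" "c = 0" by auto
    with sq(1,4) \<open>a + d \<noteq> 0\<close> show False by auto
  qed
  then show "U $ 1 $ 1 + U $ 2 $ 2 = 2"
    by (simp add: X algebra_simps)
  have d: "d = - a" using tr by (simp add: add_eq_0_iff)
  have "det U = (1 + a) * (1 + d) - b * c"
    by (simp add: det_2 X)
  also have "\<dots> = 1 - (a * a + b * c)"
    by (simp add: d algebra_simps)
  finally show "det U = 1"
    using sq(1) by simp
qed

text \<open>
  Discriminant of the characteristic polynomial.
\<close>

definition disc2 :: "cmat \<Rightarrow> complex" where
  "disc2 A = (A $ 1 $ 1 + A $ 2 $ 2)\<^sup>2 - 4 * det A"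

lemma semisimple_scalar_or_disc2:
  assumes "semisimple_mat S"
  shows "(\<exists>\<mu>. S = \<mu> \<odot> mat 1) \<or> disc2 S \<noteq> 0"
proof -
  obtain P \<Lambda> :: cmat where P: "invertible P" "S ** P = P ** \<Lambda>"
    and diag: "\<And>i j. i \<noteq> j \<Longrightarrow> \<Lambda> $ i $ j = 0"
    using assms unfolding semisimple_mat_def by blast
  have S: "S = P ** \<Lambda> ** inv2 P"
    by (metis P inv2_right matrix_mul_assoc matrix_mul_rid)
  have off: "\<Lambda> $ 1 $ 2 = 0" "\<Lambda> $ 2 $ 1 = 0"
    using diag[of 1 2] diag[of 2 1] by auto
  show ?thesis
  proof (cases "\<Lambda> $ 1 $ 1 = \<Lambda> $ 2 $ 2")
    case True
    then have "\<Lambda> = (\<Lambda> $ 1 $ 1) \<odot> mat 1"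
      using off by (simp add: mat2_entries)
    then have "S = (\<Lambda> $ 1 $ 1) \<odot> mat 1"
      by (metis S P(1) inv2_right matrix_mul_rid mscale_left mscale_right)
    then show ?thesis by blast
  next
    case False
    have "det P \<noteq> 0"
      using P(1) by (simp add: invertible_det_nz)
    have char: "(x - S $ 1 $ 1) * (x - S $ 2 $ 2) - S $ 1 $ 2 * S $ 2 $ 1
        = (x - \<Lambda> $ 1 $ 1) * (x - \<Lambda> $ 2 $ 2)" for x
    proof -
      have "(x \<odot> mat 1 - S) ** P = P ** (x \<odot> mat 1 - \<Lambda>)"
        by (simp add: matmul_diff_left matmul_diff_right mscale_left mscale_right P(2))
      then have "det (x \<odot> mat 1 - S) = det (x \<odot> mat 1 - \<Lambda>)"
        using \<open>det P \<noteq> 0\<close> by (metis det_mul mult.commute mult_cancel_left)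
      then show ?thesis
        by (simp add: det_2 mscale_nth mat2_nth off)
    qed
    have det: "det S = \<Lambda> $ 1 $ 1 * \<Lambda> $ 2 $ 2"
      using char[of 0] by (simp add: det_2)
    have tr: "S $ 1 $ 1 + S $ 2 $ 2 = \<Lambda> $ 1 $ 1 + \<Lambda> $ 2 $ 2"
      using char[of 0] char[of 1] by (simp add: algebra_simps)
    have "disc2 S = (\<Lambda> $ 1 $ 1 - \<Lambda> $ 2 $ 2)\<^sup>2"
      unfolding disc2_def det tr by (simp add: power2_eq_square algebra_simps)
    with False show ?thesis by simp
  qed
qed

text \<open>
  Up to scalar matrices and multiples of \<open>X\<close>, nothing commutes with a nonzero nilpotent \<open>X\<close>, so
  the two eigenvalues of \<open>S\<close> coincide. The proof multiplies the discriminant by the squares of the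
  off-diagonal entries of \<open>X\<close>, one of which is nonzero.
\<close>

lemma disc2_commutes_nilpotent:
  assumes "X ** X = 0" "S ** X = X ** S" "X \<noteq> 0"
  shows "disc2 S = 0"
proof -
  define a b c where X: "a = X $ 1 $ 1" "b = X $ 1 $ 2" "c = X $ 2 $ 1"
  define p q r s where S: "p = S $ 1 $ 1" "q = S $ 1 $ 2" "r = S $ 2 $ 1" "s = S $ 2 $ 2"
  have "unipotent_mat (X + mat 1)"
    using assms(1) by (simp add: unipotent_mat_def)
  then have tr: "X $ 2 $ 2 = - a"
    using unipotent_trace_det(1) by (fastforce simp: X mat2_nth add_eq_0_iff2)
  have sq: "a * a + b * c = 0"
    using assms(1) by (simp add: mat2_entries X)
  have comm: "p * a + q * c = a * p + b * r" "p * b + q * X $ 2 $ 2 = a * q + b * s"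
    "r * a + s * c = c * p + X $ 2 $ 2 * r"
    using assms(2) by (simp_all add: mat2_entries X S)
  have disc: "disc2 S = (p - s)\<^sup>2 + 4 * q * r"
    by (simp add: disc2_def det_2 S power2_eq_square algebra_simps)
  have b: "b * (p - s) = 2 * q * a" and c: "c * (p - s) = 2 * r * a"
    using comm(2,3) unfolding tr by (simp_all add: algebra_simps)
  have qc: "q * c = r * b"
    using comm(1) by (simp add: mult.commute)
  have "b\<^sup>2 * disc2 S = (b * (p - s))\<^sup>2 + 4 * q * b * (r * b)"
    by (simp add: disc power2_eq_square algebra_simps)
  also have "\<dots> = 4 * q\<^sup>2 * (a * a + b * c)"
    unfolding b qc[symmetric] by (simp add: power2_eq_square algebra_simps)
  finally have b0: "b = 0 \<or> disc2 S = 0"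
    by (simp add: sq)
  have "c\<^sup>2 * disc2 S = (c * (p - s))\<^sup>2 + 4 * r * c * (q * c)"
    by (simp add: disc power2_eq_square algebra_simps)
  also have "\<dots> = 4 * r\<^sup>2 * (a * a + b * c)"
    unfolding c qc by (simp add: power2_eq_square algebra_simps)
  finally have c0: "c = 0 \<or> disc2 S = 0"
    by (simp add: sq)
  show ?thesis
  proof (rule ccontr)
    assume "disc2 S \<noteq> 0"
    with b0 c0 sq have "a = 0" "b = 0" "c = 0" by auto
    then have "X = 0"
      using tr by (simp add: mat2_entries X)
    with assms(3) show False ..
  qed
qed

text \<open>
  In another decomposition \<open>S ** V\<close> of a matrix with a double eigenvalue the semisimple factor
  must be scalar: if \<open>V \<noteq> 1\<close>, then \<open>S\<close> commutes with the nonzero nilpotent \<open>V - 1\<close>, and if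
  \<open>V = 1\<close>, then \<open>S\<close> is the given matrix; in both cases \<open>disc2 S = 0\<close>. Comparing traces
  identifies the scalar.
\<close>

lemma unipotent_part_eq:
  assumes U: "unipotent_mat U" and l: "l \<noteq> 0"
  shows "unipotent_part (l \<odot> U) = U"
  unfolding unipotent_part_def
proof (rule the_equality)
  have "semisimple_mat (l \<odot> mat 1)"
    unfolding semisimple_mat_def
    by (intro exI[of _ "mat 1"] exI[of _ "l \<odot> mat 1"])
      (auto simp: invertible_def mscale_nth intro: exI[of _ "mat 1"], simp add: mat_def)
  then show "\<exists>S. semisimple_mat S \<and> unipotent_mat U \<and> l \<odot> U = S ** U \<and> S ** U = U ** S"
    using U by (intro exI[of _ "l \<odot> mat 1"]) (simp add: mscale_left mscale_right)
next
  fix V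
  assume "\<exists>S. semisimple_mat S \<and> unipotent_mat V \<and> l \<odot> U = S ** V \<and> S ** V = V ** S"
  then obtain S where S: "semisimple_mat S" and V: "unipotent_mat V"
    and dec: "l \<odot> U = S ** V" and comm: "S ** V = V ** S"
    by blast
  have disc: "disc2 (l \<odot> U) = 0"
  proof -
    have "disc2 (l \<odot> U) = l\<^sup>2 * ((U $ 1 $ 1 + U $ 2 $ 2)\<^sup>2 - 4 * det U)"
      by (simp add: disc2_def det_2 mscale_nth power2_eq_square algebra_simps)
    then show ?thesis
      by (simp add: unipotent_trace_det[OF U])
  qed
  have "disc2 S = 0"
  proof (cases "V = mat 1")
    case True
    with dec disc show ?thesis by simp
  next
    case False
    then show ?thesis
      using disc2_commutes_nilpotent[of "V - mat 1" S] V comm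
      by (simp add: unipotent_mat_def matmul_diff_left matmul_diff_right)
  qed
  then obtain \<mu> where \<mu>: "S = \<mu> \<odot> mat 1"
    using semisimple_scalar_or_disc2[OF S] by blast
  have eq: "l \<odot> U = \<mu> \<odot> V"
    using dec by (simp add: \<mu> mscale_left)
  have "l * (U $ 1 $ 1 + U $ 2 $ 2) = \<mu> * (V $ 1 $ 1 + V $ 2 $ 2)"
    using eq by (simp add: mat2_entries distrib_left)
  then have "l = \<mu>"
    by (simp add: unipotent_trace_det[OF U] unipotent_trace_det[OF V])
  with eq l show "V = U"
    by (simp add: mat2_entries)
qed

lemma flat_basis_has_mderiv:
  assumes "flat_basis B \<Phi>"
  shows "has_mderiv \<Phi> (- (exp (- w) \<odot> (B (exp w) ** \<Phi> w))) w"
proof -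
  have "has_mderiv \<Phi> (mat_deriv \<Phi> w) w"
    using assms by (auto simp: flat_basis_def intro!: mat_holomorphic_on_has_mderiv[of _ UNIV])
  moreover have "mat_deriv \<Phi> w = - (exp (- w) \<odot> (B (exp w) ** \<Phi> w))"
    using assms by (simp add: flat_basis_def eq_neg_iff_add_eq_0)
  ultimately show ?thesis by simp
qed

lemma flat_basisI:
  assumes "\<And>w. has_mderiv \<Phi> (- (exp (- w) \<odot> (B (exp w) ** \<Phi> w))) w" "\<And>w. invertible (\<Phi> w)"
  shows "flat_basis B \<Phi>"
  unfolding flat_basis_def
proof (intro conjI allI)
  show "mat_holomorphic_on \<Phi> UNIV"
    by (rule has_mderiv_imp_mat_holomorphic_on, rule assms(1))
  show "invertible (\<Phi> w)" "mat_deriv \<Phi> w + exp (- w) \<odot> (B (exp w) ** \<Phi> w) = 0" for w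
    by (simp_all add: assms(2) has_mderiv_imp_mat_deriv[OF assms(1)])
qed

lemma has_mderiv_zero_constant:
  assumes "\<And>w. has_mderiv F 0 w"
  shows "F w = F w'"
proof -
  have "F w $ i $ j = F w' $ i $ j" for i j
  proof -
    have "\<exists>c. \<forall>x\<in>UNIV. F x $ i $ j = c"
      by (rule has_field_derivative_zero_constant) (use has_mderivD[OF assms, of i j] in simp_all)
    then show ?thesis by auto
  qed
  then show ?thesis by (simp add: vec_eq_iff)
qed

text \<open>
  The quotient of two flat bases is constant.
\<close>

lemma flat_basis_unique:
  assumes \<Phi>: "flat_basis B \<Phi>" "\<Phi> 0 = mat 1" and \<Psi>: "flat_basis B \<Psi>" "\<Psi> 0 = mat 1"
  shows "\<Phi> w = \<Psi> w"
proof -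
  have inv: "invertible (\<Phi> w)" for w
    using \<Phi>(1) by (simp add: flat_basis_def)
  have "has_mderiv (\<lambda>w. inv2 (\<Phi> w) ** \<Psi> w) 0 w" for w
  proof -
    let ?A = "exp (- w) \<odot> B (exp w)"
    have "has_mderiv (\<lambda>w. inv2 (\<Phi> w) ** \<Psi> w)
      (- (inv2 (\<Phi> w) ** (- (?A ** \<Phi> w)) ** inv2 (\<Phi> w)) ** \<Psi> w + inv2 (\<Phi> w) ** (- (?A ** \<Psi> w))) w"
      using has_mderiv_matmul[OF has_mderiv_inv[OF flat_basis_has_mderiv[OF \<Phi>(1)] inv]
          flat_basis_has_mderiv[OF \<Psi>(1)], of w]
      by (simp add: mscale_left)
    also have "- (inv2 (\<Phi> w) ** (- (?A ** \<Phi> w)) ** inv2 (\<Phi> w)) ** \<Psi> w + inv2 (\<Phi> w) ** (- (?A ** \<Psi> w))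
      = inv2 (\<Phi> w) ** ?A ** (\<Phi> w ** inv2 (\<Phi> w)) ** \<Psi> w - inv2 (\<Phi> w) ** ?A ** \<Psi> w"
      by (simp only: matmul_minus_left matmul_minus_right matrix_mul_assoc minus_minus
          add_uminus_conv_diff)
    also have "\<dots> = 0"
      by (simp add: inv2_right[OF inv])
    finally show ?thesis .
  qed
  then have "inv2 (\<Phi> w) ** \<Psi> w = inv2 (\<Phi> 0) ** \<Psi> 0"
    by (rule has_mderiv_zero_constant)
  also have "\<dots> = mat 1"
    using inv2_left[OF inv[of 0]] by (simp add: \<Phi>(2) \<Psi>(2))
  finally have "\<Phi> w ** (inv2 (\<Phi> w) ** \<Psi> w) = \<Phi> w"
    by simp
  then show ?thesis
    by (simp add: matrix_mul_assoc inv2_right[OF inv])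
qed

text \<open>
  A flat basis need not be normalized at \<open>0\<close> to compute the monodromy: right multiplication by
  the inverse of its initial value normalizes it and conjugates the monodromy matrix \<open>A\<close>.
\<close>

lemma monodromy_eq:
  assumes "flat_basis B \<Psi>" "\<Psi> (2 * of_real pi * \<i>) = \<Psi> 0 ** A"
  shows "monodromy B = \<Psi> 0 ** A ** inv2 (\<Psi> 0)"
proof -
  have inv: "invertible (\<Psi> w)" for w
    using assms(1) by (simp add: flat_basis_def)
  define \<Phi> where "\<Phi> w = \<Psi> w ** inv2 (\<Psi> 0)" for w
  have "flat_basis B \<Phi>"
  proof (rule flat_basisI)
    fix w
    show "has_mderiv \<Phi> (- (exp (- w) \<odot> (B (exp w) ** \<Phi> w))) w"
      unfolding \<Phi>_def
      using has_mderiv_matmul[OF flat_basis_has_mderiv[OF assms(1)] has_mderiv_const[of "inv2 (\<Psi> 0)"], of w]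
      by (simp add: matmul_minus_left mscale_left matrix_mul_assoc)
    have "invertible (inv2 (\<Psi> 0))"
      using inv2_left[OF inv[of 0]] inv2_right[OF inv[of 0]] invertible_def by blast
    then show "invertible (\<Phi> w)"
      unfolding \<Phi>_def by (rule invertible_mult[OF inv])
  qed
  moreover have "\<Phi> 0 = mat 1"
    by (simp add: \<Phi>_def inv2_right[OF inv])
  ultimately have "monodromy B = \<Phi> (2 * of_real pi * \<i>)"
    unfolding monodromy_def
    by (intro the_equality) (blast, metis flat_basis_unique)
  then show ?thesis
    by (simp add: \<Phi>_def assms(2))
qed

text \<open>
  Pulling back along \<open>exp\<close> turns \<open>z \<partial>\<^sub>z\<close> into \<open>\<partial>\<^sub>w\<close>.
\<close>

lemma nabla_minus_derivative:
  assumes "(\<lambda>z. s z $ i) holomorphic_on - {0}" "nabla_minus B \<alpha> s (exp w) = u"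
  shows "((\<lambda>w. s (exp w) $ i) has_field_derivative
    \<alpha> * s (exp w) $ i + u $ i - exp (- w) * (B (exp w) *v s (exp w)) $ i) (at w)"
proof -
  have d: "((\<lambda>z. s z $ i) has_field_derivative deriv (\<lambda>z. s z $ i) (exp w)) (at (exp w))"
    by (rule holomorphic_derivI[OF assms(1)]) auto
  have "((\<lambda>w. s (exp w) $ i) has_field_derivative deriv (\<lambda>z. s z $ i) (exp w) * exp w) (at w)"
    using DERIV_chain2[OF d DERIV_exp] .
  moreover have "deriv (\<lambda>z. s z $ i) (exp w) * exp w
      = \<alpha> * s (exp w) $ i + u $ i - exp (- w) * (B (exp w) *v s (exp w)) $ i"
    unfolding assms(2)[symmetric] nabla_minus_def
    by (simp add: exp_minus field_simps)
  ultimately show ?thesis by simp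
qed

lemma singular_kernel:
  assumes "det (A :: cmat) = 0"
  obtains c1 c2 where "c1 \<noteq> 0 \<or> c2 \<noteq> 0" "\<And>i. A $ i $ 1 * c1 + A $ i $ 2 * c2 = 0"
proof (cases "A $ 1 $ 1 = 0 \<and> A $ 1 $ 2 = 0")
  case False
  have "A $ i $ 1 * A $ 1 $ 2 + A $ i $ 2 * (- A $ 1 $ 1) = 0" for i
    using assms exhaust_2[of i] by (auto simp: det_2 algebra_simps)
  then show thesis
    using that[of "A $ 1 $ 2" "- A $ 1 $ 1"] False by auto
next
  case row1: True
  show thesis
  proof (cases "A $ 2 $ 1 = 0 \<and> A $ 2 $ 2 = 0")
    case True
    have "A $ i $ 1 * 1 + A $ i $ 2 * 0 = 0" for i
      using row1 True exhaust_2[of i] by auto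
    then show thesis using that[of 1 0] by auto
  next
    case False
    have "A $ i $ 1 * A $ 2 $ 2 + A $ i $ 2 * (- A $ 2 $ 1) = 0" for i
      using row1 exhaust_2[of i] by (auto simp: algebra_simps)
    then show thesis
      using that[of "A $ 2 $ 2" "- A $ 2 $ 1"] False by auto
  qed
qed

lemma nabla_minus_holomorphic:
  assumes "te_point B" "\<And>i. (\<lambda>z. s z $ i) holomorphic_on - {0}"
  shows "(\<lambda>z. nabla_minus B \<alpha> s z $ i) holomorphic_on - {0}"
proof -
  have "(\<lambda>z. B z $ i $ j) holomorphic_on - {0}" for i j
    using assms(1) holomorphic_on_subset by (fastforce simp: te_point_def mat_holomorphic_on_def)
  then show ?thesis
    unfolding nabla_minus_def vec_lambda_beta matvec2_nth
    by (intro holomorphic_on_diff holomorphic_on_add holomorphic_on_mult holomorphic_on_divide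
        holomorphic_on_const holomorphic_on_ident holomorphic_deriv assms) auto
qed

text \<open>
  Let \<open>u = (\<nabla> - \<alpha>) s\<close>. Since \<open>(\<nabla> - \<alpha>) u = 0\<close>, the columns
  \<open>exp (- \<alpha> w) u\<close> and \<open>exp (- \<alpha> w) (s - w u)\<close>, with \<open>u\<close> and \<open>s\<close> taken at \<open>exp w\<close>, are flat.
  A linear relation between them at one point holds everywhere, and subtracting it from its
  translate by \<open>2 \<pi> \<i>\<close>, which changes only the factor \<open>w\<close>, leaves a multiple of \<open>u\<close>; so the
  columns are independent. The translation acts on them by \<open>exp (- 2 \<pi> \<i> \<alpha>)\<close> times a nontrivial
  unipotent matrix.
\<close>

lemma N_mon_nonzero:
  assumes H: "te_point H" and s: "s \<in> C_space H \<alpha>"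
    and nz: "z0 \<noteq> 0" "nabla_minus H \<alpha> s z0 \<noteq> 0"
  shows "N_mon H \<noteq> 0"
proof -
  define u where "u = nabla_minus H \<alpha> s"
  have hs: "(\<lambda>z. s z $ i) holomorphic_on - {0}" for i
    using s by (simp add: C_space_def)
  have hu: "(\<lambda>z. u z $ i) holomorphic_on - {0}" for i
    unfolding u_def by (rule nabla_minus_holomorphic[OF H hs])
  have Hhol: "(\<lambda>w. H (exp w) $ i $ j) holomorphic_on UNIV" for i j
  proof -
    have "(\<lambda>z. H z $ i $ j) holomorphic_on UNIV"
      using H by (simp add: te_point_def mat_holomorphic_on_def)
    then have "((\<lambda>z. H z $ i $ j) \<circ> exp) holomorphic_on UNIV"
      by (intro holomorphic_on_compose_gen[of exp UNIV _ UNIV]) (auto intro: holomorphic_intros)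
    then show ?thesis by (simp add: o_def)
  qed
  have Lu: "nabla_minus H \<alpha> u (exp w) = 0" for w
    using s by (simp add: C_space_def u_def)
  have Ls: "nabla_minus H \<alpha> s (exp w) = u (exp w)" for w
    by (simp add: u_def)
  define \<Psi> :: "complex \<Rightarrow> cmat" where
    "\<Psi> w = (\<chi> i j. if j = 1 then exp (- (\<alpha> * w)) * u (exp w) $ i
      else exp (- (\<alpha> * w)) * (s (exp w) $ i - w * u (exp w) $ i))" for w
  have \<Psi>_nth: "\<Psi> w $ i $ 1 = exp (- (\<alpha> * w)) * u (exp w) $ i"
    "\<Psi> w $ i $ 2 = exp (- (\<alpha> * w)) * (s (exp w) $ i - w * u (exp w) $ i)" for w i
    by (simp_all add: \<Psi>_def)
  let ?A = "\<lambda>w. - (exp (- w) \<odot> H (exp w))"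
  have flat: "has_mderiv \<Psi> (- (exp (- w) \<odot> (H (exp w) ** \<Psi> w))) w" for w
  proof -
    note du = nabla_minus_derivative[OF hu Lu]
    note ds = nabla_minus_derivative[OF hs Ls]
    have "((\<lambda>w. \<Psi> w $ i $ 1) has_field_derivative
        (- (exp (- w) \<odot> (H (exp w) ** \<Psi> w))) $ i $ 1) (at w)" for i
      unfolding \<Psi>_nth
      by (auto intro!: derivative_eq_intros du
          simp: \<Psi>_nth mscale_nth matmul2_nth matvec2_nth algebra_simps)
    moreover have "((\<lambda>w. \<Psi> w $ i $ 2) has_field_derivative
        (- (exp (- w) \<odot> (H (exp w) ** \<Psi> w))) $ i $ 2) (at w)" for i
      unfolding \<Psi>_nth
      by (auto intro!: derivative_eq_intros du ds
          simp: \<Psi>_nth mscale_nth matmul2_nth matvec2_nth algebra_simps)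
    ultimately show ?thesis
      unfolding has_mderiv_def forall_2[where P = "\<lambda>j. ((\<lambda>w. \<Psi> w $ i $ j) has_field_derivative d j) (at w)" for i d]
      by blast
  qed
  define p :: complex where "p = 2 * of_real pi * \<i>"
  have exp_p: "exp (w + p) = exp w" "p \<noteq> 0" for w
    by (simp_all add: p_def exp_add exp_two_pi_i)
  obtain w0 i0 where w0: "u (exp w0) $ i0 \<noteq> 0"
    using nz by (auto simp: u_def vec_eq_iff) (metis exp_Ln)
  have "det (\<Psi> w) \<noteq> 0" for w
  proof
    assume "det (\<Psi> w) = 0"
    then obtain c1 c2 where c: "c1 \<noteq> 0 \<or> c2 \<noteq> 0" "\<And>i. \<Psi> w $ i $ 1 * c1 + \<Psi> w $ i $ 2 * c2 = 0"
      using singular_kernel by metis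
    define y where "y i w = \<Psi> w $ i $ 1 * c1 + \<Psi> w $ i $ 2 * c2" for i w
    have dy: "(y i has_field_derivative ?A w $ i $ 1 * y 1 w + ?A w $ i $ 2 * y 2 w) (at w)" for i w
      unfolding y_def
      by (rule derivative_eq_intros refl has_mderivD[OF flat])+
        (simp add: mscale_nth matmul2_nth algebra_simps)
    have Ahol: "(\<lambda>w. ?A w $ i $ j) holomorphic_on UNIV" for i j
      by (auto simp: mscale_nth intro!: holomorphic_intros Hhol)
    have "y i w' = 0" for i w'
      using linear_system_unique[of UNIV "\<lambda>w. ?A w $ 1 $ 1" "\<lambda>w. ?A w $ 1 $ 2" "\<lambda>w. ?A w $ 2 $ 1"
          "\<lambda>w. ?A w $ 2 $ 2" "y 1" "y 2" w w'] Ahol dy c(2) exhaust_2[of i]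
      by (auto simp: y_def)
    then have rel: "u (exp w') $ i * c1 + (s (exp w') $ i - w' * u (exp w') $ i) * c2 = 0" for i w'
      by (simp add: y_def \<Psi>_nth distrib_left[symmetric] mult.assoc)
    \<comment> \<open>The relation at \<open>w0 + p\<close> minus the one at \<open>w0\<close>.\<close>
    have "p * u (exp w0) $ i0 * c2 = 0"
      using rel[of w0 i0] rel[of "w0 + p" i0] unfolding exp_p(1) by (simp add: algebra_simps)
    with w0 exp_p(2) have "c2 = 0" by simp
    with rel[of w0 i0] w0 c(1) show False by simp
  qed
  then have inv: "invertible (\<Psi> w)" for w
    by (simp add: invertible_det_nz)
  define l where "l = exp (- (\<alpha> * p))"
  define N :: cmat where "N = vector [vector [0, - p], vector [0, 0]]"
  have N_nth: "N $ 1 $ 1 = 0" "N $ 1 $ 2 = - p" "N $ 2 $ 1 = 0" "N $ 2 $ 2 = 0"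
    by (simp_all add: N_def)
  have "exp p = 1" using exp_p(1)[of 0] by simp
  have "\<Psi> p $ i $ 1 = (\<Psi> 0 ** (l \<odot> (mat 1 + N))) $ i $ 1"
    "\<Psi> p $ i $ 2 = (\<Psi> 0 ** (l \<odot> (mat 1 + N))) $ i $ 2" for i
    by (simp_all add: \<Psi>_nth matmul2_nth mscale_nth mat2_nth N_nth l_def \<open>exp p = 1\<close> algebra_simps)
  then have "\<Psi> p = \<Psi> 0 ** (l \<odot> (mat 1 + N))"
    by (simp only: vec_eq_iff forall_2)
  then have "monodromy H = \<Psi> 0 ** (l \<odot> (mat 1 + N)) ** inv2 (\<Psi> 0)"
    unfolding p_def by (rule monodromy_eq[OF flat_basisI[OF flat inv]])
  moreover define X where "X = \<Psi> 0 ** N ** inv2 (\<Psi> 0)"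
  ultimately have mon: "monodromy H = l \<odot> (mat 1 + X)"
    by (simp add: mscale_left mscale_right matrix_add_ldistrib matmul_add_left inv2_right[OF inv])
  have "N ** N = 0"
    by (simp add: mat2_entries N_nth)
  have "X ** X = \<Psi> 0 ** N ** (inv2 (\<Psi> 0) ** \<Psi> 0) ** N ** inv2 (\<Psi> 0)"
    by (simp only: X_def matrix_mul_assoc)
  also have "\<dots> = \<Psi> 0 ** (N ** N) ** inv2 (\<Psi> 0)"
    by (simp add: inv2_left[OF inv] matrix_mul_assoc)
  finally have "unipotent_mat (mat 1 + X)"
    by (simp add: unipotent_mat_def \<open>N ** N = 0\<close>)
  then have "unipotent_part (monodromy H) = mat 1 + X"
    unfolding mon by (rule unipotent_part_eq) (simp add: l_def)
  then have "N_mon H = X"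
    by (simp add: N_mon_def)
  moreover have "X \<noteq> 0"
  proof
    assume "X = 0"
    then have "inv2 (\<Psi> 0) ** X ** \<Psi> 0 = 0" by simp
    then have "(inv2 (\<Psi> 0) ** \<Psi> 0) ** N ** (inv2 (\<Psi> 0) ** \<Psi> 0) = 0"
      by (simp only: X_def matrix_mul_assoc)
    then have "N = 0"
      by (simp add: inv2_left[OF inv])
    with exp_p(2) show False
      by (simp add: mat2_entries N_nth)
  qed
  ultimately show ?thesis by simp
qed


section \<open>Classification of the logarithmic normal forms\<close>

lemma te_point_iso_refl: "te_point_iso B B"
  by (rule te_point_isoI[of "\<lambda>_. mat 1" "\<lambda>_. 0"])
    (auto simp: has_mderiv_const invertible_def mat2_entries intro: exI[of _ "mat 1"])

text \<open>
  Exchanging the two basis vectors.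
\<close>

lemma te_point_iso_upper_triangular:
  "te_point_iso (\<lambda>z. vector [vector [z * a, z * r z], vector [0, z * b]]) (log_form b a r)"
proof -
  let ?P = "vector [vector [0, 1], vector [1, 0]] :: cmat"
  have "?P ** ?P = mat 1"
    by (simp add: mat2_entries)
  then have "invertible ?P"
    using invertible_def by blast
  then show ?thesis
    by (intro te_point_isoI[of "\<lambda>_. ?P" "\<lambda>_. 0"]) (auto simp: has_mderiv_const mat2_entries)
qed

text \<open>
  The gauge equation between two forms is divisible by \<open>z\<close>; after the division it still holds at
  \<open>0\<close> by continuity.
\<close>

lemma log_form_iso_gauge:
  assumes "te_point_iso (log_form a b r) (log_form a' b' r')"
    and r: "r holomorphic_on UNIV" "r' holomorphic_on UNIV"
  obtains T where "mat_holomorphic_on T UNIV" "\<And>z. det (T z) \<noteq> 0"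
    "\<And>z. z * deriv (\<lambda>w. T w $ 1 $ 1) z + a' * T z $ 1 $ 1 = a * T z $ 1 $ 1 + r z * T z $ 1 $ 2"
    "\<And>z. z * deriv (\<lambda>w. T w $ 1 $ 2) z + a' * T z $ 1 $ 2 = b * T z $ 1 $ 2"
    "\<And>z. z * deriv (\<lambda>w. T w $ 2 $ 1) z + r' z * T z $ 1 $ 1 + b' * T z $ 2 $ 1
      = a * T z $ 2 $ 1 + r z * T z $ 2 $ 2"
    "\<And>z. z * deriv (\<lambda>w. T w $ 2 $ 2) z + r' z * T z $ 1 $ 2 + b' * T z $ 2 $ 2 = b * T z $ 2 $ 2"
proof -
  obtain T where T: "mat_holomorphic_on T UNIV" and inv: "\<And>z. invertible (T z)"
    and eq: "\<And>z. z\<^sup>2 \<odot> mat_deriv T z + log_form a' b' r' z ** T z = T z ** log_form a b r z"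
    using assms(1) unfolding te_point_iso_def by auto
  have ent: "(\<lambda>z. T z $ i $ j) holomorphic_on UNIV" for i j
    using T by (simp add: mat_holomorphic_on_def)
  have dent: "deriv (\<lambda>z. T z $ i $ j) holomorphic_on UNIV" for i j
    by (rule holomorphic_deriv[OF ent]) auto
  have cancel: "f z = g z"
    if fg: "f holomorphic_on UNIV" "g holomorphic_on UNIV" and eq: "\<And>z. z * f z = z * g z"
    for f g :: "complex \<Rightarrow> complex" and z
  proof -
    have "f w = g w" if "w \<noteq> 0" for w
      using eq[of w] that by simp
    then show ?thesis
      using isCont_eq_at_0[OF fg[THEN entire_isCont]] by (cases "z = 0") auto
  qed
  have eqs: "z\<^sup>2 * deriv (\<lambda>w. T w $ i $ j) z + (log_form a' b' r' z ** T z) $ i $ j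
      = (T z ** log_form a b r z) $ i $ j" for z i j
    using arg_cong[OF eq[of z], of "\<lambda>M. M $ i $ j"] by (simp add: mscale_nth mat_deriv_def)
  have 1: "z * deriv (\<lambda>w. T w $ 1 $ 1) z + a' * T z $ 1 $ 1
      = a * T z $ 1 $ 1 + r z * T z $ 1 $ 2" for z
    by (rule cancel[of "\<lambda>z. z * deriv (\<lambda>w. T w $ 1 $ 1) z + a' * T z $ 1 $ 1"])
      (use eqs[of _ 1 1] in \<open>auto intro!: holomorphic_intros ent dent r
        simp: matmul2_nth algebra_simps power2_eq_square\<close>)
  have 2: "z * deriv (\<lambda>w. T w $ 1 $ 2) z + a' * T z $ 1 $ 2 = b * T z $ 1 $ 2" for z
    by (rule cancel[of "\<lambda>z. z * deriv (\<lambda>w. T w $ 1 $ 2) z + a' * T z $ 1 $ 2"])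
      (use eqs[of _ 1 2] in \<open>auto intro!: holomorphic_intros ent dent r
        simp: matmul2_nth algebra_simps power2_eq_square\<close>)
  have 3: "z * deriv (\<lambda>w. T w $ 2 $ 1) z + r' z * T z $ 1 $ 1 + b' * T z $ 2 $ 1
      = a * T z $ 2 $ 1 + r z * T z $ 2 $ 2" for z
    by (rule cancel[of "\<lambda>z. z * deriv (\<lambda>w. T w $ 2 $ 1) z + r' z * T z $ 1 $ 1 + b' * T z $ 2 $ 1"])
      (use eqs[of _ 2 1] in \<open>auto intro!: holomorphic_intros ent dent r
        simp: matmul2_nth algebra_simps power2_eq_square\<close>)
  have 4: "z * deriv (\<lambda>w. T w $ 2 $ 2) z + r' z * T z $ 1 $ 2 + b' * T z $ 2 $ 2
      = b * T z $ 2 $ 2" for z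
    by (rule cancel[of "\<lambda>z. z * deriv (\<lambda>w. T w $ 2 $ 2) z + r' z * T z $ 1 $ 2 + b' * T z $ 2 $ 2"])
      (use eqs[of _ 2 2] in \<open>auto intro!: holomorphic_intros ent dent r
        simp: matmul2_nth algebra_simps power2_eq_square\<close>)
  show thesis
    by (rule that[OF T _ 1 2 3 4]) (use inv in \<open>simp add: invertible_det_nz\<close>)
qed

text \<open>
  At \<open>z = 0\<close> the divided gauge equation says that the residue matrices are similar, so that their
  characteristic polynomials agree.
\<close>

lemma log_form_iso_residue:
  assumes "te_point_iso (log_form a b r) (log_form a' b' r')"
    "r holomorphic_on UNIV" "r' holomorphic_on UNIV"
  shows "a + b = a' + b'" "a * b = a' * b'"
proof -
  obtain T :: "complex \<Rightarrow> cmat" where T: "\<And>z. det (T z) \<noteq> 0"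
    and eqs: "\<And>z. z * deriv (\<lambda>w. T w $ 1 $ 1) z + a' * T z $ 1 $ 1 = a * T z $ 1 $ 1 + r z * T z $ 1 $ 2"
    "\<And>z. z * deriv (\<lambda>w. T w $ 1 $ 2) z + a' * T z $ 1 $ 2 = b * T z $ 1 $ 2"
    "\<And>z. z * deriv (\<lambda>w. T w $ 2 $ 1) z + r' z * T z $ 1 $ 1 + b' * T z $ 2 $ 1
      = a * T z $ 2 $ 1 + r z * T z $ 2 $ 2"
    "\<And>z. z * deriv (\<lambda>w. T w $ 2 $ 2) z + r' z * T z $ 1 $ 2 + b' * T z $ 2 $ 2 = b * T z $ 2 $ 2"
    by (rule log_form_iso_gauge[OF assms]) blast
  let ?K = "\<lambda>x. vector [vector [x - a, 0], vector [- r 0, x - b]] :: cmat"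
  let ?K' = "\<lambda>x. vector [vector [x - a', 0], vector [- r' 0, x - b']] :: cmat"
  have "?K' x ** T 0 = T 0 ** ?K x" for x
  proof -
    note eqs0 = eqs[of 0, unfolded mult_zero_left add_0]
    have "(x - a') * T 0 $ 1 $ 1 = T 0 $ 1 $ 1 * (x - a) + T 0 $ 1 $ 2 * (- r 0)"
      "(x - a') * T 0 $ 1 $ 2 = T 0 $ 1 $ 2 * (x - b)"
      "- r' 0 * T 0 $ 1 $ 1 + (x - b') * T 0 $ 2 $ 1 = T 0 $ 2 $ 1 * (x - a) + T 0 $ 2 $ 2 * (- r 0)"
      "- r' 0 * T 0 $ 1 $ 2 + (x - b') * T 0 $ 2 $ 2 = T 0 $ 2 $ 2 * (x - b)"
      using eqs0(1) eqs0(2) eqs0(3) eqs0(4) by algebra+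
    then show ?thesis
      by (simp add: mat2_entries)
  qed
  then have "det (?K' x) * det (T 0) = det (T 0) * det (?K x)" for x
    unfolding det_mul[symmetric] by simp
  then have "det (?K' x) = det (?K x)" for x
    using T[of 0] by (simp add: mult.commute)
  then have char: "(x - a') * (x - b') = (x - a) * (x - b)" for x
    by (simp add: det_2)
  show "a * b = a' * b'"
    using char[of 0] by simp
  with char[of 1] show "a + b = a' + b'"
    by algebra
qed

lemma higher_deriv_euler:
  assumes "f holomorphic_on UNIV"
  shows "(deriv ^^ k) (\<lambda>z. z * deriv f z) = (\<lambda>z. z * (deriv ^^ Suc k) f z + of_nat k * (deriv ^^ k) f z)"
proof (induction k)
  case (Suc k)
  have d: "((deriv ^^ n) f has_field_derivative (deriv ^^ Suc n) f z) (at z)" for n z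
    by (rule has_field_derivative_higher_deriv[OF assms]) auto
  show ?case
  proof
    fix z
    have "((\<lambda>z. z * (deriv ^^ Suc k) f z + of_nat k * (deriv ^^ k) f z) has_field_derivative
        z * (deriv ^^ Suc (Suc k)) f z + of_nat (Suc k) * (deriv ^^ Suc k) f z) (at z)"
      by (rule derivative_eq_intros d refl)+ (simp add: algebra_simps)
    then show "(deriv ^^ Suc k) (\<lambda>z. z * deriv f z) z
        = z * (deriv ^^ Suc (Suc k)) f z + of_nat (Suc k) * (deriv ^^ Suc k) f z"
      by (simp add: Suc DERIV_imp_deriv)
  qed
qed simp

text \<open>
  Off the zeros of \<open>g\<close> the quotient \<open>f / g\<close> would be a logarithm of \<open>z\<close>. On Taylor coefficients
  the equations read \<open>(k - \<mu>) g\<^sub>k = 0\<close> and \<open>(k - \<mu>) f\<^sub>k = g\<^sub>k\<close>, hence all \<open>g\<^sub>k\<close> vanish.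
\<close>

lemma no_entire_logarithm:
  assumes f: "f holomorphic_on UNIV" and g: "g holomorphic_on UNIV"
    and eqf: "\<And>z. z * deriv f z = \<mu> * f z + g z" and eqg: "\<And>z. z * deriv g z = \<mu> * g z"
  shows "g z = 0"
proof (rule holomorphic_fun_eq_0_on_connected[OF g open_UNIV connected_UNIV])
  fix k
  let ?f = "(deriv ^^ k) f 0" and ?g = "(deriv ^^ k) g 0"
  have "(deriv ^^ k) (\<lambda>z. \<mu> * f z + g z) 0 = \<mu> * ?f + ?g"
    using higher_deriv_add[of "\<lambda>z. \<mu> * f z" UNIV g 0 k] higher_deriv_cmult[OF f, of 0 k \<mu>] f g
    by (simp add: holomorphic_intros)
  then have kf: "of_nat k * ?f = \<mu> * ?f + ?g"
    using higher_deriv_euler[OF f, of k] by (simp add: eqf)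
  have kg: "of_nat k * ?g = \<mu> * ?g"
    using higher_deriv_euler[OF g, of k] higher_deriv_cmult[OF g, of 0 k \<mu>] by (simp add: eqg)
  show "?g = 0"
    using kf kg by (cases "of_nat k = \<mu>") auto
qed auto

text \<open>
  Each row \<open>(x, y)\<close> of a gauge transformation gives an entire pair \<open>x, z ^ n * y\<close> to which the
  absence of entire logarithms applies, so its second column would vanish.
\<close>

lemma log_form_nilpotent_not_semisimple:
  assumes "a - b = of_nat n"
  shows "\<not> te_point_iso (log_form a b (\<lambda>z. z ^ n)) (log_form c d (\<lambda>_. 0))"
proof
  assume iso: "te_point_iso (log_form a b (\<lambda>z. z ^ n)) (log_form c d (\<lambda>_. 0))"
  obtain T where T: "mat_holomorphic_on T UNIV" "\<And>z. det (T z) \<noteq> 0"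
    and eqs: "\<And>z. z * deriv (\<lambda>w. T w $ 1 $ 1) z + c * T z $ 1 $ 1
      = a * T z $ 1 $ 1 + z ^ n * T z $ 1 $ 2"
    "\<And>z. z * deriv (\<lambda>w. T w $ 1 $ 2) z + c * T z $ 1 $ 2 = b * T z $ 1 $ 2"
    "\<And>z. z * deriv (\<lambda>w. T w $ 2 $ 1) z + 0 * T z $ 1 $ 1 + d * T z $ 2 $ 1
      = a * T z $ 2 $ 1 + z ^ n * T z $ 2 $ 2"
    "\<And>z. z * deriv (\<lambda>w. T w $ 2 $ 2) z + 0 * T z $ 1 $ 2 + d * T z $ 2 $ 2 = b * T z $ 2 $ 2"
    by (rule log_form_iso_gauge[OF iso]) (auto intro: holomorphic_intros)
  have ent: "(\<lambda>z. T z $ i $ j) holomorphic_on UNIV" for i j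
    using T(1) by (simp add: mat_holomorphic_on_def)
  have y0: "y 1 = 0" if x: "x holomorphic_on UNIV" and y: "y holomorphic_on UNIV"
    and dx: "\<And>z. z * deriv x z + e * x z = a * x z + z ^ n * y z"
    and dy: "\<And>z. z * deriv y z + e * y z = b * y z" for x y :: "complex \<Rightarrow> complex" and e
  proof -
    \<comment> \<open>The factor \<open>z ^ n\<close> raises the exponent of \<open>y\<close> from \<open>b - e\<close> to \<open>a - e\<close>, since \<open>n = a - b\<close>.\<close>
    have "z * deriv (\<lambda>z. z ^ n * y z) z = (a - e) * (z ^ n * y z)" for z
    proof -
      have "((\<lambda>z. z ^ n * y z) has_field_derivative of_nat n * z ^ (n - 1) * y z + z ^ n * deriv y z) (at z)"
        by (rule derivative_eq_intros refl holomorphic_derivI[OF y])+ auto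
      then have "z * deriv (\<lambda>z. z ^ n * y z) z
          = of_nat n * (z * z ^ (n - 1)) * y z + z ^ n * (z * deriv y z)"
        by (simp add: DERIV_imp_deriv algebra_simps)
      also have "of_nat n * (z * z ^ (n - 1)) = of_nat n * z ^ n"
        by (cases n) auto
      also have "z * deriv y z = (b - e) * y z"
        using dy[of z] by (simp add: algebra_simps)
      finally show ?thesis
        unfolding assms[symmetric] by (simp add: algebra_simps)
    qed
    moreover have "z * deriv x z = (a - e) * x z + z ^ n * y z" for z
      using dx[of z] by (simp add: algebra_simps)
    ultimately have "1 ^ n * y 1 = 0"
      by (intro no_entire_logarithm[OF x, of "\<lambda>z. z ^ n * y z" "a - e"]) (auto intro!: holomorphic_intros y)
    then show ?thesis by simp
  qed
  have "T 1 $ 1 $ 2 = 0" "T 1 $ 2 $ 2 = 0"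
    using y0[OF ent ent eqs(1,2)] y0[OF ent ent, of 2 1 d 2 2] eqs(3,4) by simp_all
  with T(2)[of 1] show False
    by (simp add: det_2)
qed

text \<open>
  For \<open>N_mon = 0\<close> the monodromy shows that both sections are eigensections. For \<open>N_mon \<noteq> 0\<close>,
  \<open>(\<nabla> - \<alpha>1)\<^sup>2 s\<^sub>1 = 0\<close> means that \<open>\<nabla> - \<alpha>1\<close> annihilates \<open>z ^ n s\<^sub>2\<close>, hence \<open>\<nabla> - \<alpha>2\<close> annihilates
  \<open>s\<^sub>2\<close>.
\<close>

lemma leading_exponents_iso:
  assumes H: "te_point H" and lead: "leading_exponents H \<alpha>1 \<alpha>2"
  shows "N_mon H = 0 \<Longrightarrow> te_point_iso (log_form \<alpha>1 \<alpha>2 (\<lambda>_. 0)) H"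
    and "N_mon H \<noteq> 0 \<Longrightarrow> \<exists>n. \<alpha>1 - \<alpha>2 = of_nat n \<and> te_point_iso (log_form \<alpha>1 \<alpha>2 (\<lambda>z. z ^ n)) H"
proof -
  assume N: "N_mon H = 0"
  then obtain s1 s2 where s: "s1 \<in> C_space H \<alpha>1" "s2 \<in> C_space H \<alpha>2" "O0_direct_sum s1 s2"
    using lead unfolding leading_exponents_def by auto
  have "nabla_minus H \<alpha>1 s1 z = 0" "nabla_minus H \<alpha>2 s2 z = 0" if "z \<noteq> 0" for z
    using N_mon_nonzero[OF H s(1) that] N_mon_nonzero[OF H s(2) that] N by blast+
  with s show "te_point_iso (log_form \<alpha>1 \<alpha>2 (\<lambda>_. 0)) H"
    by (intro te_point_iso_log_form[OF H]) (auto simp: C_space_def)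
next
  assume N: "N_mon H \<noteq> 0"
  then obtain s1 s2 and n :: nat where n: "\<alpha>1 - \<alpha>2 = of_nat n"
    and s: "s1 \<in> C_space H \<alpha>1" "s2 \<in> C_space H \<alpha>2" "O0_direct_sum s1 s2"
    and s12: "\<And>z. z \<noteq> 0 \<Longrightarrow> nabla_minus H \<alpha>1 s1 z = z ^ n *s s2 z"
    using lead unfolding leading_exponents_def by auto
  have hol: "(\<lambda>z. s2 z $ i) holomorphic_on - {0}" for i
    using s(2) by (simp add: C_space_def)
  have "nabla_minus H \<alpha>2 s2 z = 0" if z: "z \<noteq> 0" for z
  proof -
    define u where "u = nabla_minus H \<alpha>1 s1"
    have u: "u w $ i = w ^ n * s2 w $ i" if "w \<noteq> 0" for w i
      by (simp add: u_def s12[OF that])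
    have "z ^ n * nabla_minus H \<alpha>2 s2 z $ i = nabla_minus H \<alpha>1 u z $ i" for i
    proof -
      have "\<forall>\<^sub>F w in nhds z. w \<in> - {0}"
        using z by (intro eventually_nhds_in_open) auto
      then have "\<forall>\<^sub>F w in nhds z. u w $ i = w ^ n * s2 w $ i"
        by (auto elim!: eventually_mono simp: u)
      then have "deriv (\<lambda>w. u w $ i) z = deriv (\<lambda>w. w ^ n * s2 w $ i) z"
        by (rule deriv_cong_ev) simp
      also have "\<dots> = of_nat n * z ^ (n - 1) * s2 z $ i + z ^ n * deriv (\<lambda>w. s2 w $ i) z"
        by (rule DERIV_imp_deriv)
          (rule derivative_eq_intros refl holomorphic_derivI[OF hol] | use z in auto)+
      finally have "z * deriv (\<lambda>w. u w $ i) z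
          = of_nat n * (z * z ^ (n - 1)) * s2 z $ i + z ^ n * (z * deriv (\<lambda>w. s2 w $ i) z)"
        by (simp add: algebra_simps)
      also have "of_nat n * (z * z ^ (n - 1)) = (\<alpha>1 - \<alpha>2) * z ^ n"
        unfolding n by (cases n) auto
      finally show ?thesis
        unfolding nabla_minus_def vec_lambda_beta
        by (simp add: u[OF z] matvec2_nth algebra_simps add_divide_distrib)
    qed
    then show ?thesis
      using s(1) z by (simp add: C_space_def vec_eq_iff u_def)
  qed
  with s s12 n show "\<exists>n. \<alpha>1 - \<alpha>2 = of_nat n \<and> te_point_iso (log_form \<alpha>1 \<alpha>2 (\<lambda>z. z ^ n)) H"
    by (intro exI[of _ n] conjI te_point_iso_log_form[OF H, where ?s1.0 = s1 and ?s2.0 = s2])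
      (auto simp: C_space_def intro: holomorphic_intros)
qed

lemma sum_prod_eq_iff:
  fixes a b c d :: complex
  shows "a + b = c + d \<and> a * b = c * d \<longleftrightarrow> a + b = c + d \<and> (a - b = c - d \<or> a - b = d - c)"
proof -
  have "(a - b - (c - d)) * (a - b - (d - c)) = 0 \<longleftrightarrow> a * b = c * d" if s: "a + b = c + d"
  proof -
    have "(a - b - (c - d)) * (a - b - (d - c)) = (a + b)\<^sup>2 - 4 * (a * b) - (c + d)\<^sup>2 + 4 * (c * d)"
      by (simp add: power2_eq_square algebra_simps)
    then show ?thesis unfolding s by auto
  qed
  then show ?thesis by auto
qed

lemma sum_diff_eq:
  fixes x y u v :: complex
  assumes "x + y = u + v" "x - y = u - v"
  shows "x = u \<and> y = v"
proof -
  have "2 * x = (x + y) + (x - y)" "2 * y = (x + y) - (x - y)" by simp_all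
  then have "2 * x = 2 * u" "2 * y = 2 * v" unfolding assms by simp_all
  then show ?thesis by simp
qed

lemma iso_semisimple_iff:
  assumes H: "te_point H" and lead: "leading_exponents H \<alpha>1 \<alpha>2"
  shows "te_point_iso (log_form a b (\<lambda>_. 0)) H \<longleftrightarrow>
    N_mon H = 0 \<and> a + b = \<alpha>1 + \<alpha>2 \<and> (\<alpha>1 - \<alpha>2 = a - b \<or> \<alpha>1 - \<alpha>2 = b - a)"
proof
  assume iso: "te_point_iso (log_form a b (\<lambda>_. 0)) H"
  have N: "N_mon H = 0"
  proof (rule ccontr)
    assume "N_mon H \<noteq> 0"
    then obtain n where "\<alpha>1 - \<alpha>2 = of_nat n" "te_point_iso (log_form \<alpha>1 \<alpha>2 (\<lambda>z. z ^ n)) H"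
      using leading_exponents_iso(2)[OF H lead] by blast
    then show False
      using log_form_nilpotent_not_semisimple te_point_iso_trans te_point_iso_sym[OF iso] by blast
  qed
  then have "te_point_iso (log_form \<alpha>1 \<alpha>2 (\<lambda>_. 0)) (log_form a b (\<lambda>_. 0))"
    using leading_exponents_iso(1)[OF H lead] te_point_iso_trans te_point_iso_sym[OF iso] by blast
  then show "N_mon H = 0 \<and> a + b = \<alpha>1 + \<alpha>2 \<and> (\<alpha>1 - \<alpha>2 = a - b \<or> \<alpha>1 - \<alpha>2 = b - a)"
    using log_form_iso_residue[of \<alpha>1 \<alpha>2 _ a b] sum_prod_eq_iff[of \<alpha>1 \<alpha>2 a b] N by simp
next
  assume R: "N_mon H = 0 \<and> a + b = \<alpha>1 + \<alpha>2 \<and> (\<alpha>1 - \<alpha>2 = a - b \<or> \<alpha>1 - \<alpha>2 = b - a)"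
  have swap: "te_point_iso (log_form a b (\<lambda>_. 0)) (log_form b a (\<lambda>_. 0))"
    using te_point_iso_upper_triangular[of a "\<lambda>_. 0" b] by (simp add: log_form_def[abs_def])
  have "(a = \<alpha>1 \<and> b = \<alpha>2) \<or> (b = \<alpha>1 \<and> a = \<alpha>2)"
  proof -
    have "a + b = \<alpha>1 + \<alpha>2" "b + a = \<alpha>1 + \<alpha>2" "a - b = \<alpha>1 - \<alpha>2 \<or> b - a = \<alpha>1 - \<alpha>2"
      using R by (auto simp: add.commute)
    then show ?thesis
      using sum_diff_eq[of a b \<alpha>1 \<alpha>2] sum_diff_eq[of b a \<alpha>1 \<alpha>2] by blast
  qed
  then show "te_point_iso (log_form a b (\<lambda>_. 0)) H"
    using leading_exponents_iso(1)[OF H lead] R swap te_point_iso_trans by blast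
qed

lemma iso_nilpotent_iff:
  assumes H: "te_point H" and lead: "leading_exponents H \<alpha>1 \<alpha>2" and ab: "a - b = of_nat m"
  shows "te_point_iso (log_form a b (\<lambda>z. z ^ m)) H \<longleftrightarrow>
    N_mon H \<noteq> 0 \<and> a + b = \<alpha>1 + \<alpha>2 \<and> \<alpha>1 - \<alpha>2 = of_nat m"
proof
  assume iso: "te_point_iso (log_form a b (\<lambda>z. z ^ m)) H"
  have N: "N_mon H \<noteq> 0"
  proof
    assume "N_mon H = 0"
    then have "te_point_iso (log_form a b (\<lambda>z. z ^ m)) (log_form \<alpha>1 \<alpha>2 (\<lambda>_. 0))"
      by (rule te_point_iso_trans[OF iso te_point_iso_sym[OF leading_exponents_iso(1)[OF H lead]]])
    with log_form_nilpotent_not_semisimple[OF ab] show False by blast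
  qed
  then obtain n where n: "\<alpha>1 - \<alpha>2 = of_nat n" "te_point_iso (log_form \<alpha>1 \<alpha>2 (\<lambda>z. z ^ n)) H"
    using leading_exponents_iso(2)[OF H lead] by blast
  have "te_point_iso (log_form a b (\<lambda>z. z ^ m)) (log_form \<alpha>1 \<alpha>2 (\<lambda>z. z ^ n))"
    by (rule te_point_iso_trans[OF iso te_point_iso_sym[OF n(2)]])
  then have eqs: "a + b = \<alpha>1 + \<alpha>2" "a * b = \<alpha>1 * \<alpha>2"
    by (rule log_form_iso_residue; auto intro: holomorphic_intros)+
  then have "of_nat m = (of_nat n :: complex) \<or> of_nat m = - (of_nat n :: complex)"
    using sum_prod_eq_iff[of a b \<alpha>1 \<alpha>2] minus_diff_eq[of \<alpha>1 \<alpha>2] unfolding ab n(1) by auto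
  moreover have "m = 0 \<and> n = 0" if "of_nat m = - (of_nat n :: complex)"
  proof -
    have "of_nat (m + n) = (0 :: complex)" using that by simp
    then show ?thesis unfolding of_nat_eq_0_iff by simp
  qed
  ultimately have "m = n" by auto
  with N n eqs show "N_mon H \<noteq> 0 \<and> a + b = \<alpha>1 + \<alpha>2 \<and> \<alpha>1 - \<alpha>2 = of_nat m"
    by simp
next
  assume R: "N_mon H \<noteq> 0 \<and> a + b = \<alpha>1 + \<alpha>2 \<and> \<alpha>1 - \<alpha>2 = of_nat m"
  then obtain n where n: "\<alpha>1 - \<alpha>2 = of_nat n" "te_point_iso (log_form \<alpha>1 \<alpha>2 (\<lambda>z. z ^ n)) H"
    using leading_exponents_iso(2)[OF H lead] by blast
  then have "n = m" using R by simp
  have "a = \<alpha>1" "b = \<alpha>2"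
    using sum_diff_eq[of a b \<alpha>1 \<alpha>2] R ab by simp_all
  with n \<open>n = m\<close> show "te_point_iso (log_form a b (\<lambda>z. z ^ m)) H" by simp
qed


section \<open>The normal forms as germs\<close>

definition holomorphic3 :: "(complex \<Rightarrow> complex \<Rightarrow> complex \<Rightarrow> complex) \<Rightarrow> bool" where
  "holomorphic3 f \<longleftrightarrow> (\<forall>p. \<exists>L. ((\<lambda>(z, t1, t2). f z t1 t2) has_derivative L) (at p) \<and>
        (\<forall>c u v w. L (c * u, c * v, c * w) = c * L (u, v, w)))"

lemma mat_holomorphic3_iff:
  "mat_holomorphic3_on F UNIV \<longleftrightarrow> (\<forall>i j. holomorphic3 (\<lambda>z t1 t2. F z t1 t2 $ i $ j))"
  by (simp add: mat_holomorphic3_on_def holomorphic3_def)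

lemma holomorphic3I:
  assumes "\<And>p. ((\<lambda>(z, t1, t2). f z t1 t2) has_derivative L p) (at p)"
    and "\<And>p c u v w. L p (c * u, c * v, c * w) = c * L p (u, v, w)"
  shows "holomorphic3 f"
  unfolding holomorphic3_def using assms by blast

lemma holomorphic3E:
  assumes "holomorphic3 f"
  obtains L where "\<And>p. ((\<lambda>(z, t1, t2). f z t1 t2) has_derivative L p) (at p)"
    "\<And>p c u v w. L p (c * u, c * v, c * w) = c * L p (u, v, w)"
  using assms unfolding holomorphic3_def by metis

named_theorems holomorphic3_intros

lemma holomorphic3_const [holomorphic3_intros]: "holomorphic3 (\<lambda>z t1 t2. c)"
  by (rule holomorphic3I[of _ "\<lambda>_ _. 0"]) (auto simp: case_prod_unfold)

lemma holomorphic3_proj [holomorphic3_intros]: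
  "holomorphic3 (\<lambda>z t1 t2. z)" "holomorphic3 (\<lambda>z t1 t2. t1)" "holomorphic3 (\<lambda>z t1 t2. t2)"
proof -
  show "holomorphic3 (\<lambda>z t1 t2. z)"
    by (rule holomorphic3I[of _ "\<lambda>_ h. fst h"])
      (auto simp: case_prod_unfold intro!: derivative_eq_intros)
  show "holomorphic3 (\<lambda>z t1 t2. t1)"
    by (rule holomorphic3I[of _ "\<lambda>_ h. fst (snd h)"])
      (auto simp: case_prod_unfold intro!: derivative_eq_intros)
  show "holomorphic3 (\<lambda>z t1 t2. t2)"
    by (rule holomorphic3I[of _ "\<lambda>_ h. snd (snd h)"])
      (auto simp: case_prod_unfold intro!: derivative_eq_intros)
qed

lemma holomorphic3_add [holomorphic3_intros]:
  assumes "holomorphic3 f" "holomorphic3 g"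
  shows "holomorphic3 (\<lambda>z t1 t2. f z t1 t2 + g z t1 t2)"
proof -
  obtain L where L: "\<And>p. ((\<lambda>(z, t1, t2). f z t1 t2) has_derivative L p) (at p)"
    "\<And>p c u v w. L p (c * u, c * v, c * w) = c * L p (u, v, w)"
    by (rule holomorphic3E[OF assms(1)]) blast
  obtain M where M: "\<And>p. ((\<lambda>(z, t1, t2). g z t1 t2) has_derivative M p) (at p)"
    "\<And>p c u v w. M p (c * u, c * v, c * w) = c * M p (u, v, w)"
    by (rule holomorphic3E[OF assms(2)]) blast
  show ?thesis
    by (rule holomorphic3I[of _ "\<lambda>p h. L p h + M p h"])
      (use has_derivative_add[OF L(1) M(1)] L(2) M(2) in
        \<open>auto simp: case_prod_unfold distrib_left\<close>)
qed

lemma holomorphic3_mult [holomorphic3_intros]: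
  assumes "holomorphic3 f" "holomorphic3 g"
  shows "holomorphic3 (\<lambda>z t1 t2. f z t1 t2 * g z t1 t2)"
proof -
  obtain L where L: "\<And>p. ((\<lambda>(z, t1, t2). f z t1 t2) has_derivative L p) (at p)"
    "\<And>p c u v w. L p (c * u, c * v, c * w) = c * L p (u, v, w)"
    by (rule holomorphic3E[OF assms(1)]) blast
  obtain M where M: "\<And>p. ((\<lambda>(z, t1, t2). g z t1 t2) has_derivative M p) (at p)"
    "\<And>p c u v w. M p (c * u, c * v, c * w) = c * M p (u, v, w)"
    by (rule holomorphic3E[OF assms(2)]) blast
  show ?thesis
    by (rule holomorphic3I[of _ "\<lambda>p h. f (fst p) (fst (snd p)) (snd (snd p)) * M p h
          + L p h * g (fst p) (fst (snd p)) (snd (snd p))"])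
      (use has_derivative_mult[OF L(1) M(1)] L(2) M(2) in
        \<open>auto simp: case_prod_unfold algebra_simps\<close>)
qed

lemma holomorphic3_uminus [holomorphic3_intros]:
  "holomorphic3 f \<Longrightarrow> holomorphic3 (\<lambda>z t1 t2. - f z t1 t2)"
  using holomorphic3_mult[OF holomorphic3_const[of "-1"]] by simp

lemma holomorphic3_diff [holomorphic3_intros]:
  "holomorphic3 f \<Longrightarrow> holomorphic3 g \<Longrightarrow> holomorphic3 (\<lambda>z t1 t2. f z t1 t2 - g z t1 t2)"
  using holomorphic3_add[of f "\<lambda>z t1 t2. - g z t1 t2"] holomorphic3_uminus by simp

lemma holomorphic3_power [holomorphic3_intros]:
  "holomorphic3 f \<Longrightarrow> holomorphic3 (\<lambda>z t1 t2. f z t1 t2 ^ n)"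
  by (induction n) (auto intro!: holomorphic3_intros)

lemma mat_holomorphic3_intros [holomorphic3_intros]:
  "mat_holomorphic3_on (\<lambda>z t1 t2. M) UNIV"
  "mat_holomorphic3_on F UNIV \<Longrightarrow> mat_holomorphic3_on G UNIV \<Longrightarrow>
    mat_holomorphic3_on (\<lambda>z t1 t2. F z t1 t2 + G z t1 t2) UNIV"
  "mat_holomorphic3_on F UNIV \<Longrightarrow> mat_holomorphic3_on G UNIV \<Longrightarrow>
    mat_holomorphic3_on (\<lambda>z t1 t2. F z t1 t2 - G z t1 t2) UNIV"
  "holomorphic3 f \<Longrightarrow> mat_holomorphic3_on F UNIV \<Longrightarrow>
    mat_holomorphic3_on (\<lambda>z t1 t2. f z t1 t2 \<odot> F z t1 t2) UNIV"
  unfolding mat_holomorphic3_iff mscale_nth vector_add_component vector_minus_component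
  by (simp_all add: holomorphic3_intros)

lemma basis_mat_nth [simp]:
  "C1 $ 1 $ 1 = 1" "C1 $ 1 $ 2 = 0" "C1 $ 2 $ 1 = 0" "C1 $ 2 $ 2 = 1"
  "C2 $ 1 $ 1 = 0" "C2 $ 1 $ 2 = 0" "C2 $ 2 $ 1 = 1" "C2 $ 2 $ 2 = 0"
  "Dm $ 1 $ 1 = 1" "Dm $ 1 $ 2 = 0" "Dm $ 2 $ 1 = 0" "Dm $ 2 $ 2 = -1"
  "Em $ 1 $ 1 = 0" "Em $ 1 $ 2 = 1" "Em $ 2 $ 1 = 0" "Em $ 2 $ 2 = 0"
  by (simp_all add: C1_def C2_def Dm_def Em_def)

lemma weight_identities:
  fixes x y :: complex
  assumes "x + y \<noteq> 0"
  shows "2 / (x + y) * x = 1 + 2 * ((x - y) / (2 * (x + y)))"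
    and "2 / (x + y) * y = 1 - 2 * ((x - y) / (2 * (x + y)))"
    and "1 / (x + y) * x = 1 + 2 * (- y / (2 * (x + y)))"
    and "1 / (x + y) * (x + 2 * y) = 1 - 2 * (- y / (2 * (x + y)))"
proof -
  obtain s where s: "x = s - y" "s \<noteq> 0"
    using assms that[of "x + y"] by simp
  show "2 / (x + y) * x = 1 + 2 * ((x - y) / (2 * (x + y)))"
    "2 / (x + y) * y = 1 - 2 * ((x - y) / (2 * (x + y)))"
    "1 / (x + y) * x = 1 + 2 * (- y / (2 * (x + y)))"
    "1 / (x + y) * (x + 2 * y) = 1 - 2 * (- y / (2 * (x + y)))"
    unfolding s(1) using s(2) by (simp_all add: field_simps)
qed

text \<open>
  Quasihomogeneity of the matrices \<open>A\<^sub>2\<close>: the exponents of \<open>t\<close> in front of \<open>C2\<close>, \<open>Dm\<close> and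
  \<open>Em\<close> are fixed by the weights, because \<open>C2\<close> and \<open>Em\<close> are eigenvectors of the commutator with
  \<open>Dm\<close> for the eigenvalues \<open>\<plusminus> 2\<close>. A zero coefficient carries no condition, so the monomials that a
  member of the list does not have need no case distinction afterwards.
\<close>

lemma nf_A2_weights:
  assumes "admissible X"
  obtains p q e :: complex and k l m :: nat where
    "nf_A2 X = (\<lambda>t. (p * t ^ k) \<odot> C2 + (q * t ^ l) \<odot> Dm + (e * t ^ m) \<odot> Em)"
    "p = 0 \<or> te_gamma X * of_nat (k + 1) = 1 + 2 * te_beta X"
    "q = 0 \<or> te_gamma X * of_nat (l + 1) = 1"
    "e = 0 \<or> te_gamma X * of_nat (m + 1) = 1 - 2 * te_beta X"
proof (cases X)
  case (Sem_odd k1 k2)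
  have k: "k1 \<ge> 1" "k2 \<ge> 1" "of_nat k1 + of_nat k2 \<noteq> (0 :: complex)"
    using assms Sem_odd unfolding of_nat_add[symmetric] of_nat_eq_0_iff by auto
  have i: "k1 - 1 + 1 = k1" "k2 - 1 + 1 = k2" using k by simp_all
  show thesis
  proof (rule that[of "- inverse (te_gamma X)" "k1 - 1" 0 0 "- inverse (te_gamma X)" "k2 - 1"])
    show "nf_A2 X = (\<lambda>t. (- inverse (te_gamma X) * t ^ (k1 - 1)) \<odot> C2 + (0 * t ^ 0) \<odot> Dm
        + (- inverse (te_gamma X) * t ^ (k2 - 1)) \<odot> Em)"
      by (simp add: Sem_odd fun_eq_iff mat2_entries)
    show "- inverse (te_gamma X) = 0 \<or> te_gamma X * of_nat (k1 - 1 + 1) = 1 + 2 * te_beta X"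
      "- inverse (te_gamma X) = 0 \<or> te_gamma X * of_nat (k2 - 1 + 1) = 1 - 2 * te_beta X"
      unfolding i Sem_odd te_gamma.simps te_beta.simps of_nat_add weight_identities[OF k(3)] by simp_all
  qed simp
next
  case (Sem_even k1 k2 \<zeta>)
  then have "even (k2 - k1)" "k1 < k2" using assms by auto
  then have "even (k1 + k2)" by auto
  then obtain n where n: "k1 + k2 = 2 * n" by (rule evenE)
  have k: "k1 \<ge> 1" "k2 \<ge> 1" "n \<ge> 1" "of_nat k1 + of_nat k2 \<noteq> (0 :: complex)"
    using assms n Sem_even unfolding of_nat_add[symmetric] of_nat_eq_0_iff by auto
  have n': "of_nat k1 + of_nat k2 = 2 * (of_nat n :: complex)"
    using arg_cong[OF n, of "of_nat :: nat \<Rightarrow> complex"] by simp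
  show thesis
  proof (rule that[of "- inverse (te_gamma X)" "k1 - 1" "- inverse (te_gamma X) * \<zeta>" "n - 1"
          "- inverse (te_gamma X) * (1 - \<zeta>\<^sup>2)" "k2 - 1"])
    show "nf_A2 X = (\<lambda>t. (- inverse (te_gamma X) * t ^ (k1 - 1)) \<odot> C2
        + (- inverse (te_gamma X) * \<zeta> * t ^ (n - 1)) \<odot> Dm
        + (- inverse (te_gamma X) * (1 - \<zeta>\<^sup>2) * t ^ (k2 - 1)) \<odot> Em)"
      unfolding Sem_even nf_A2.simps n
      by (simp add: fun_eq_iff mat2_entries mult.assoc del: te_gamma.simps)
    have i: "k1 - 1 + 1 = k1" "k2 - 1 + 1 = k2" "n - 1 + 1 = n" using k by simp_all
    show "- inverse (te_gamma X) = 0 \<or> te_gamma X * of_nat (k1 - 1 + 1) = 1 + 2 * te_beta X"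
      "- inverse (te_gamma X) * (1 - \<zeta>\<^sup>2) = 0 \<or> te_gamma X * of_nat (k2 - 1 + 1) = 1 - 2 * te_beta X"
      unfolding i Sem_even te_gamma.simps te_beta.simps of_nat_add weight_identities[OF k(4)] by simp_all
    show "- inverse (te_gamma X) * \<zeta> = 0 \<or> te_gamma X * of_nat (n - 1 + 1) = 1"
      unfolding i using k(3) by (simp add: Sem_even n')
  qed
next
  case (Sem_eq k1 k2 \<alpha>3)
  then have k: "k1 \<ge> 1" "k2 = k1" using assms by auto
  then show thesis
    by (intro that[of 0 0 "- inverse (te_gamma X)" "k1 - 1" 0 0])
      (simp_all add: Sem_eq fun_eq_iff mat2_entries field_simps)
next
  case (Bra k1 k2)
  have k: "k1 \<ge> 1" "of_nat k1 + of_nat k2 \<noteq> (0 :: complex)"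
    using assms Bra unfolding of_nat_add[symmetric] of_nat_eq_0_iff by auto
  have i: "k1 - 1 + 1 = k1" "k1 + k2 - 1 + 1 = k1 + k2" "k1 + 2 * k2 - 1 + 1 = k1 + 2 * k2"
    using k by simp_all
  show thesis
  proof (rule that[of "- inverse (te_gamma X)" "k1 - 1" "- inverse (te_gamma X)" "k1 + k2 - 1"
          "inverse (te_gamma X)" "k1 + 2 * k2 - 1"])
    show "nf_A2 X = (\<lambda>t. (- inverse (te_gamma X) * t ^ (k1 - 1)) \<odot> C2
        + (- inverse (te_gamma X) * t ^ (k1 + k2 - 1)) \<odot> Dm
        + (inverse (te_gamma X) * t ^ (k1 + 2 * k2 - 1)) \<odot> Em)"
      by (simp add: Bra fun_eq_iff mat2_entries del: te_gamma.simps)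
    show "- inverse (te_gamma X) = 0 \<or> te_gamma X * of_nat (k1 - 1 + 1) = 1 + 2 * te_beta X"
      "- inverse (te_gamma X) = 0 \<or> te_gamma X * of_nat (k1 + k2 - 1 + 1) = 1"
      "inverse (te_gamma X) = 0 \<or> te_gamma X * of_nat (k1 + 2 * k2 - 1 + 1) = 1 - 2 * te_beta X"
      unfolding i Bra te_gamma.simps te_beta.simps of_nat_add of_nat_mult of_nat_numeral
        weight_identities[OF k(2)]
      using k(2) by simp_all
  qed
next
  case (Reg_semisimple k1 \<alpha>4)
  then have "k1 \<ge> 1" using assms by auto
  then show thesis
    by (intro that[of "- inverse (te_gamma X)" "k1 - 1" 0 0 0 0])
      (simp_all add: Reg_semisimple fun_eq_iff mat2_entries)
next
  case (Reg_nilpotent kt \<alpha>4)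
  then have "kt \<ge> 1" using assms by auto
  then show thesis
    by (intro that[of "of_nat kt" "kt - 1" 0 0 0 0])
      (simp_all add: Reg_nilpotent fun_eq_iff mat2_entries)
next
  case (Log k1)
  then have "k1 \<ge> 1" using assms by auto
  then show thesis
    by (intro that[of "of_nat k1" "k1 - 1" 0 0 0 0])
      (simp_all add: Log fun_eq_iff mat2_entries)
qed

lemma has_mderiv_mscale_const:
  "(f has_field_derivative f') (at z) \<Longrightarrow> has_mderiv (\<lambda>w. f w \<odot> M) (f' \<odot> M) z"
  unfolding has_mderiv_def mscale_nth by (auto intro!: derivative_eq_intros)

text \<open>
  Euler's identity for a quasihomogeneous matrix, one monomial at a time.
\<close>

lemma nf_A2_euler:
  assumes "admissible X"
  obtains A' where "has_mderiv (nf_A2 X) A' t"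
    "(1 - te_gamma X) \<odot> nf_A2 X t - (te_gamma X * t) \<odot> A'
      + te_beta X \<odot> (nf_A2 X t ** Dm - Dm ** nf_A2 X t) = 0"
proof -
  obtain p q e k l m where A: "nf_A2 X = (\<lambda>t. (p * t ^ k) \<odot> C2 + (q * t ^ l) \<odot> Dm + (e * t ^ m) \<odot> Em)"
    and w: "p = 0 \<or> te_gamma X * of_nat (k + 1) = 1 + 2 * te_beta X"
    "q = 0 \<or> te_gamma X * of_nat (l + 1) = 1"
    "e = 0 \<or> te_gamma X * of_nat (m + 1) = 1 - 2 * te_beta X"
    by (rule nf_A2_weights[OF assms]) blast
  have monom: "has_mderiv (\<lambda>t. (c * t ^ n) \<odot> M) ((c * (of_nat n * t ^ (n - 1))) \<odot> M) t" for c n M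
    by (rule has_mderiv_mscale_const) (auto intro!: derivative_eq_intros)
  have tpow: "t * (of_nat n * t ^ (n - 1)) = of_nat n * t ^ n" for n
    by (cases n) auto
  let ?A' = "(p * (of_nat k * t ^ (k - 1))) \<odot> C2 + (q * (of_nat l * t ^ (l - 1))) \<odot> Dm
    + (e * (of_nat m * t ^ (m - 1))) \<odot> Em"
  show thesis
  proof (rule that)
    show "has_mderiv (nf_A2 X) ?A' t"
      unfolding A by (intro has_mderiv_add monom)
    let ?g = "te_gamma X" and ?b = "te_beta X"
    have weight: "(w - ?g) * (c * t ^ n) - ?g * (t * (c * (of_nat n * t ^ (n - 1)))) = 0"
      if "c = 0 \<or> ?g * of_nat (n + 1) = w" for c w n
    proof -
      have "c * (?g * (of_nat n + 1)) = c * w"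
        using that by (auto simp: add.commute)
      moreover have "(w - ?g) * (c * t ^ n) - ?g * (c * (of_nat n * t ^ n))
          = (c * w - c * (?g * (of_nat n + 1))) * t ^ n"
        by (simp add: algebra_simps)
      ultimately have "(w - ?g) * (c * t ^ n) - ?g * (c * (of_nat n * t ^ n)) = 0"
        by auto
      then show ?thesis
        unfolding tpow[symmetric, of n] by (simp only: mult.left_commute)
    qed
    have "(1 - ?g) \<odot> nf_A2 X t - (?g * t) \<odot> ?A' + ?b \<odot> (nf_A2 X t ** Dm - Dm ** nf_A2 X t)
      = ((1 + 2 * ?b - ?g) * (p * t ^ k) - ?g * (t * (p * (of_nat k * t ^ (k - 1))))) \<odot> C2
        + ((1 - ?g) * (q * t ^ l) - ?g * (t * (q * (of_nat l * t ^ (l - 1))))) \<odot> Dm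
        + ((1 - 2 * ?b - ?g) * (e * t ^ m) - ?g * (t * (e * (of_nat m * t ^ (m - 1))))) \<odot> Em"
      unfolding A by (simp add: mat2_entries algebra_simps)
    also have "\<dots> = 0"
      unfolding weight[OF w(1)] weight[OF w(2)] weight[OF w(3)] by (simp add: mat2_entries)
    finally show "(1 - ?g) \<odot> nf_A2 X t - (?g * t) \<odot> ?A'
        + ?b \<odot> (nf_A2 X t ** Dm - Dm ** nf_A2 X t) = 0" .
  qed
qed

text \<open>
  Only the case \<open>\<alpha>\<^sub>4 < 0\<close> needs a computation; otherwise \<open>R\<close> is independent of \<open>t\<^sub>2\<close> and commutes
  with \<open>A\<^sub>2\<close>.
\<close>

lemma nf_R_flat:
  assumes "admissible X"
  obtains R' where "has_mderiv (nf_R X z) R' t"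
    "z \<odot> R' + (nf_A2 X t ** nf_R X z t - nf_R X z t ** nf_A2 X t) = 0"
proof (cases "\<exists>kt \<alpha>4. X = Reg_nilpotent kt \<alpha>4 \<and> \<alpha>4 < 0")
  case False
  then consider "nf_R X z = (\<lambda>_. 0)" | kt \<alpha>4 where "X = Reg_nilpotent kt \<alpha>4" "\<alpha>4 \<ge> 0"
    by (cases X) (auto simp: fun_eq_iff)
  then show thesis
  proof cases
    case 1
    then show thesis
      by (intro that[of 0]) (auto simp: has_mderiv_const mat2_entries)
  next
    case 2
    then have "nf_R X z = (\<lambda>_. z ^ nat (\<alpha>4 + 1) \<odot> C2)"
      by (simp add: fun_eq_iff)
    with 2 show thesis
      by (intro that[of 0]) (auto simp: has_mderiv_const mat2_entries)
  qed
next
  case True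
  then obtain kt \<alpha>4 where X: "X = Reg_nilpotent kt \<alpha>4" "\<alpha>4 < 0" by blast
  \<comment> \<open>The exponents of \<open>z\<close> in \<open>R\<close> are \<open>n\<close>, \<open>n + 1\<close> and \<open>n + 2\<close>.\<close>
  define n where "n = nat (- \<alpha>4 - 1)"
  have n: "nat (- \<alpha>4) = Suc n" "nat (1 - \<alpha>4) = Suc (Suc n)" "nat (- \<alpha>4 + 1) = Suc (Suc n)"
    using X(2) by (auto simp: n_def)
  obtain j where j: "kt = Suc j"
    using assms X by (cases kt) auto
  have R: "nf_R X z = (\<lambda>t. (- (z ^ n * t ^ (2 * kt))) \<odot> C2 + (z ^ Suc n * t ^ kt) \<odot> Dm
      + z ^ Suc (Suc n) \<odot> Em)"
    using X(2) n by (simp add: X(1) n_def[symmetric] fun_eq_iff)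
  let ?R' = "(- (z ^ n * (of_nat (2 * kt) * t ^ (2 * kt - 1)))) \<odot> C2
    + (z ^ Suc n * (of_nat kt * t ^ (kt - 1))) \<odot> Dm"
  show thesis
  proof (rule that)
    have d: "((\<lambda>t. - (z ^ n * t ^ (2 * kt))) has_field_derivative
        - (z ^ n * (of_nat (2 * kt) * t ^ (2 * kt - 1)))) (at t)"
      "((\<lambda>t. z ^ Suc n * t ^ kt) has_field_derivative z ^ Suc n * (of_nat kt * t ^ (kt - 1))) (at t)"
      by (auto intro!: derivative_eq_intros)
    show "has_mderiv (nf_R X z) ?R' t"
      unfolding R using has_mderiv_add[OF has_mderiv_add[OF has_mderiv_mscale_const[OF d(1)] has_mderiv_mscale_const[OF d(2)]] has_mderiv_const]
      by simp
    show "z \<odot> ?R' + (nf_A2 X t ** nf_R X z t - nf_R X z t ** nf_A2 X t) = 0"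
    proof -
      define T where "T = t ^ j"
      define K :: complex where "K = of_nat kt"
      have pow: "t ^ kt = t * T" "t ^ (kt - 1) = T" "t ^ (2 * kt) = t * T * (t * T)"
        "t ^ (2 * kt - 1) = t * T * T"
        by (simp_all add: T_def j mult_2 power_add)
      have A: "nf_A2 X t = (K * T) \<odot> C2"
        by (simp add: X(1) K_def T_def j)
      show ?thesis
        unfolding R A pow of_nat_mult of_nat_numeral K_def[symmetric] power_Suc
        by (simp add: mat2_entries)
    qed
  qed
qed

text \<open>
  The curvature in the directions \<open>t\<^sub>2\<close> and \<open>z\<close> is \<open>z\<close> times the Euler identity of \<open>A\<^sub>2\<close> plus the
  contribution of \<open>R\<close>. The other two components vanish because \<open>A\<^sub>1\<close> is the unit matrix and
  \<open>t\<^sub>1\<close> enters only through the scalar summand \<open>- t\<^sub>1\<close> of \<open>B\<close>.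
\<close>

lemma te_germ_normal_form:
  assumes X: "admissible X"
  shows "te_germ (normal_form X c1 \<rho>)"
  unfolding te_germ_def
proof (intro exI[of _ UNIV] conjI allI impI)
  let ?G = "normal_form X c1 \<rho>"
  obtain p q e k l m where A: "nf_A2 X = (\<lambda>t. (p * t ^ k) \<odot> C2 + (q * t ^ l) \<odot> Dm + (e * t ^ m) \<odot> Em)"
    by (rule nf_A2_weights[OF X]) blast
  have A2: "mat_holomorphic3_on (\<lambda>z t1 t2. nf_A2 X t2) UNIV"
    unfolding A by (intro holomorphic3_intros)
  have R: "mat_holomorphic3_on (\<lambda>z t1 t2. nf_R X z t2) UNIV"
  proof (cases X)
    case (Reg_nilpotent kt \<alpha>4)
    then show ?thesis
      by (cases "\<alpha>4 \<ge> 0") (simp_all add: holomorphic3_intros)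
  qed (simp_all add: holomorphic3_intros)
  show "mat_holomorphic3_on (te_A1 ?G) (UNIV \<times> UNIV)"
    by (simp add: normal_form_def holomorphic3_intros)
  show "mat_holomorphic3_on (te_A2 ?G) (UNIV \<times> UNIV)"
    using A2 by (simp add: normal_form_def)
  show "mat_holomorphic3_on (te_B ?G) (UNIV \<times> UNIV)"
    using A2 R by (simp add: normal_form_def holomorphic3_intros)
  fix z t1 t2 :: complex
  obtain A' where A': "has_mderiv (nf_A2 X) A' t2"
    and euler: "(1 - te_gamma X) \<odot> nf_A2 X t2 - (te_gamma X * t2) \<odot> A'
      + te_beta X \<odot> (nf_A2 X t2 ** Dm - Dm ** nf_A2 X t2) = 0"
    by (rule nf_A2_euler[OF X]) blast
  obtain R' where R': "has_mderiv (nf_R X z) R' t2"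
    and flat: "z \<odot> R' + (nf_A2 X t2 ** nf_R X z t2 - nf_R X z t2 ** nf_A2 X t2) = 0"
    by (rule nf_R_flat[OF X]) blast
  have d1: "mat_deriv (\<lambda>t. te_B ?G z t t2) t1 = -1 \<odot> C1"
    by (intro has_mderiv_imp_mat_deriv)
      (auto simp: has_mderiv_def normal_form_def mscale_nth intro!: derivative_eq_intros)
  have "((\<lambda>t. te_gamma X * t) has_field_derivative te_gamma X) (at t2)"
    by (auto intro!: derivative_eq_intros)
  from has_mderiv_mscale[OF this A']
  have dA: "has_mderiv (\<lambda>t. (te_gamma X * t) \<odot> nf_A2 X t)
      (te_gamma X \<odot> nf_A2 X t2 + (te_gamma X * t2) \<odot> A') t2" .
  have "has_mderiv (te_B ?G z t1) (0 - (te_gamma X \<odot> nf_A2 X t2 + (te_gamma X * t2) \<odot> A') + 0 + R') t2"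
    unfolding normal_form_def te2.simps
    by (intro has_mderiv_add has_mderiv_diff has_mderiv_const dA R')
  then have d2: "mat_deriv (\<lambda>t. te_B ?G z t1 t) t2
      = R' - (te_gamma X \<odot> nf_A2 X t2 + (te_gamma X * t2) \<odot> A')"
    by (simp add: has_mderiv_imp_mat_deriv)
  have d0: "mat_deriv (\<lambda>w. M) x = 0" for M x
    by (rule has_mderiv_imp_mat_deriv[OF has_mderiv_const])
  have "z \<odot> (R' - (te_gamma X \<odot> nf_A2 X t2 + (te_gamma X * t2) \<odot> A')) + z \<odot> nf_A2 X t2
      + (nf_A2 X t2 ** te_B ?G z t1 t2 - te_B ?G z t1 t2 ** nf_A2 X t2)
    = z \<odot> ((1 - te_gamma X) \<odot> nf_A2 X t2 - (te_gamma X * t2) \<odot> A'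
        + te_beta X \<odot> (nf_A2 X t2 ** Dm - Dm ** nf_A2 X t2))
      + (z \<odot> R' + (nf_A2 X t2 ** nf_R X z t2 - nf_R X z t2 ** nf_A2 X t2))"
    by (simp add: normal_form_def mat2_entries algebra_simps)
  also have "\<dots> = 0"
    unfolding euler flat by (simp add: mat2_entries)
  finally have eq3: "z \<odot> (R' - (te_gamma X \<odot> nf_A2 X t2 + (te_gamma X * t2) \<odot> A')) + z \<odot> nf_A2 X t2
      + (nf_A2 X t2 ** te_B ?G z t1 t2 - te_B ?G z t1 t2 ** nf_A2 X t2) = 0" .
  have G: "te_A1 ?G = (\<lambda>z t1 t2. C1)" "te_A2 ?G = (\<lambda>z t1 t2. nf_A2 X t2)"
    by (simp_all add: normal_form_def)
  show "let A1 = te_A1 ?G z t1 t2; A2 = te_A2 ?G z t1 t2; B = te_B ?G z t1 t2 in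
      z \<odot> mat_deriv (\<lambda>t. te_A2 ?G z t t2) t1 - z \<odot> mat_deriv (\<lambda>t. te_A1 ?G z t1 t) t2
        + (A1 ** A2 - A2 ** A1) = 0 \<and>
      z \<odot> mat_deriv (\<lambda>t. te_B ?G z t t2) t1 - z\<^sup>2 \<odot> mat_deriv (\<lambda>w. te_A1 ?G w t1 t2) z
        + z \<odot> A1 + (A1 ** B - B ** A1) = 0 \<and>
      z \<odot> mat_deriv (\<lambda>t. te_B ?G z t1 t) t2 - z\<^sup>2 \<odot> mat_deriv (\<lambda>w. te_A2 ?G w t1 t2) z
        + z \<odot> A2 + (A2 ** B - B ** A2) = 0"
    unfolding Let_def G d0 d1 d2 using eq3 by (simp add: mat2_entries)
qed auto


section \<open>Restriction of the normal forms to the origin\<close>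

text \<open>
  At \<open>z = 0\<close> the derivative drops out of the gauge equation, so the two matrices are similar
  there.
\<close>

lemma te_point_iso_log_form_vanishes:
  assumes "te_point_iso B (log_form a b r)"
  shows "B 0 = 0"
proof -
  obtain T where inv: "invertible (T 0)" and eq: "0\<^sup>2 \<odot> mat_deriv T 0 + log_form a b r 0 ** T 0 = T 0 ** B 0"
    using assms unfolding te_point_iso_def by blast
  have "log_form a b r 0 = 0"
    by (simp add: mat2_entries)
  with eq have "T 0 ** B 0 = 0"
    by (simp add: mat2_entries)
  then have "inv2 (T 0) ** (T 0 ** B 0) = 0" by simp
  then show ?thesis
    by (simp add: matrix_mul_assoc inv2_left[OF inv])
qed

lemma leading_exponents_vanishes:
  assumes "te_point H" "leading_exponents H \<alpha>1 \<alpha>2" "te_point_iso B H"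
  shows "B 0 = 0"
proof -
  obtain r where "te_point_iso (log_form \<alpha>1 \<alpha>2 r) H"
    using leading_exponents_iso[OF assms(1,2)] by blast
  then have "te_point_iso B (log_form \<alpha>1 \<alpha>2 r)"
    using te_point_iso_trans[OF assms(3) te_point_iso_sym] by blast
  then show ?thesis
    by (rule te_point_iso_log_form_vanishes)
qed

lemma normal_form_origin:
  "te_B (normal_form X c1 \<rho>) z 0 0
    = (z * \<rho> - c1) \<odot> C1 + (z * te_beta X) \<odot> Dm + nf_R X z 0"
  by (simp add: normal_form_def mat2_entries)

lemma unfolding_of_normal_form_iff:
  assumes H: "te_point H" and lead: "leading_exponents H \<alpha>1 \<alpha>2" and X: "admissible X"
  shows "unfolding_of (normal_form X c1 \<rho>) H \<longleftrightarrow>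
    c1 = 0 \<and> te_point_iso (\<lambda>z. (z * \<rho>) \<odot> C1 + (z * te_beta X) \<odot> Dm + nf_R X z 0) H"
proof -
  have R0: "nf_R X 0 0 = 0"
  proof (cases X)
    case (Reg_nilpotent kt \<alpha>4)
    then show ?thesis
      using X by (simp add: mat2_entries)
  qed simp_all
  have "c1 = 0" if "te_point_iso (\<lambda>z. te_B (normal_form X c1 \<rho>) z 0 0) H"
    using leading_exponents_vanishes[OF H lead that] unfolding normal_form_origin R0
    by (simp add: mat2_entries)
  then show ?thesis
    using te_germ_normal_form[OF X] unfolding unfolding_of_def normal_form_origin by auto
qed

lemma unfolding_semisimple_iff:
  assumes "te_point H" "leading_exponents H \<alpha>1 \<alpha>2" "admissible X" "2 * te_beta X = \<delta>"
    and R: "\<And>z. nf_R X z 0 = 0"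
  shows "unfolding_of (normal_form X c1 \<rho>) H \<longleftrightarrow> c1 = 0 \<and> \<rho> = (\<alpha>1 + \<alpha>2) / 2 \<and> N_mon H = 0 \<and>
    (\<alpha>1 - \<alpha>2 = \<delta> \<or> \<alpha>1 - \<alpha>2 = - \<delta>)"
proof -
  have "(\<lambda>z. (z * \<rho>) \<odot> C1 + (z * te_beta X) \<odot> Dm + nf_R X z 0)
      = log_form (\<rho> + te_beta X) (\<rho> - te_beta X) (\<lambda>_. 0)"
    by (simp add: fun_eq_iff mat2_entries R algebra_simps)
  moreover have "\<rho> + te_beta X + (\<rho> - te_beta X) = \<alpha>1 + \<alpha>2 \<longleftrightarrow> \<rho> = (\<alpha>1 + \<alpha>2) / 2"
    by (auto simp: field_simps)
  ultimately show ?thesis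
    unfolding unfolding_of_normal_form_iff[OF assms(1-3)]
    using iso_semisimple_iff[OF assms(1,2), of "\<rho> + te_beta X" "\<rho> - te_beta X"] assms(4) by auto
qed

text \<open>
  For \<open>\<alpha>\<^sub>4 < 0\<close> the restriction to the origin is upper triangular with the larger exponent in the
  second place, which is why only the absolute value of \<open>\<alpha>\<^sub>4\<close> survives.
\<close>

lemma unfolding_nilpotent_iff:
  assumes "te_point H" "leading_exponents H \<alpha>1 \<alpha>2" "kt \<ge> 1"
  shows "unfolding_of (normal_form (Reg_nilpotent kt \<alpha>4) c1 \<rho>) H \<longleftrightarrow>
    c1 = 0 \<and> \<rho> = (\<alpha>1 + \<alpha>2) / 2 \<and> N_mon H \<noteq> 0 \<and> \<alpha>1 - \<alpha>2 = of_int \<bar>\<alpha>4\<bar>"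
proof -
  define m where "m = nat \<bar>\<alpha>4\<bar>"
  have m: "of_nat m = (of_int \<bar>\<alpha>4\<bar> :: complex)"
    by (simp add: m_def)
  define a b :: complex where ab: "a = \<rho> + of_nat m / 2" "b = \<rho> - of_nat m / 2"
  let ?B = "\<lambda>z. (z * \<rho>) \<odot> C1 + (z * te_beta (Reg_nilpotent kt \<alpha>4)) \<odot> Dm
      + nf_R (Reg_nilpotent kt \<alpha>4) z 0"
  have "te_point_iso ?B (log_form a b (\<lambda>z. z ^ m))"
  proof (cases "\<alpha>4 \<ge> 0")
    case True
    then have "nat (\<alpha>4 + 1) = Suc m" "of_nat m = (of_int \<alpha>4 :: complex)"
      by (simp_all add: m_def)
    then have "?B = log_form a b (\<lambda>z. z ^ m)"
      using True by (simp add: fun_eq_iff mat2_entries ab algebra_simps)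
    then show ?thesis
      by (simp only: te_point_iso_refl)
  next
    case False
    then have "nat (- \<alpha>4) = m" "nat (1 - \<alpha>4) = Suc m" "of_nat m = - (of_int \<alpha>4 :: complex)"
      by (simp_all add: m_def)
    then have "?B = (\<lambda>z. vector [vector [z * b, z * z ^ m], vector [0, z * a]])"
      using False assms(3) by (simp add: fun_eq_iff mat2_entries ab algebra_simps)
    then show ?thesis
      using te_point_iso_upper_triangular[of b "\<lambda>z. z ^ m" a] by (simp only:)
  qed
  then have "te_point_iso ?B H \<longleftrightarrow> te_point_iso (log_form a b (\<lambda>z. z ^ m)) H"
    using te_point_iso_trans te_point_iso_sym by blast
  also have "\<dots> \<longleftrightarrow> N_mon H \<noteq> 0 \<and> a + b = \<alpha>1 + \<alpha>2 \<and> \<alpha>1 - \<alpha>2 = of_nat m"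
    by (rule iso_nilpotent_iff[OF assms(1,2)]) (simp add: ab)
  also have "a + b = \<alpha>1 + \<alpha>2 \<longleftrightarrow> \<rho> = (\<alpha>1 + \<alpha>2) / 2"
    by (auto simp: ab field_simps)
  finally show ?thesis
    using unfolding_of_normal_form_iff[OF assms(1,2), of "Reg_nilpotent kt \<alpha>4"] assms(3) m by auto
qed

theorem corollary8p3:
  fixes H :: "complex \<Rightarrow> cmat" and \<alpha>1 \<alpha>2 :: complex
  assumes "te_point H" and "logarithmic H" and "leading_exponents H \<alpha>1 \<alpha>2"
  shows "{(X, c1, \<rho>). admissible X \<and> unfolding_of (normal_form X c1 \<rho>) H} =
    {(X, c1, \<rho>). admissible X \<and> c1 = 0 \<and> \<rho> = (\<alpha>1 + \<alpha>2) / 2 \<and>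
      (case X of
         Sem_odd k1 k2 \<Rightarrow> N_mon H = 0 \<and>
           (\<alpha>1 - \<alpha>2 = (of_nat k1 - of_nat k2) / of_nat (k1 + k2) \<or>
            \<alpha>1 - \<alpha>2 = - ((of_nat k1 - of_nat k2) / of_nat (k1 + k2)))
       | Sem_even k1 k2 \<zeta> \<Rightarrow> N_mon H = 0 \<and>
           (\<alpha>1 - \<alpha>2 = (of_nat k1 - of_nat k2) / of_nat (k1 + k2) \<or>
            \<alpha>1 - \<alpha>2 = - ((of_nat k1 - of_nat k2) / of_nat (k1 + k2)))
       | Sem_eq k1 k2 \<alpha>3 \<Rightarrow> N_mon H = 0 \<and> (\<alpha>1 - \<alpha>2 = 2 * \<alpha>3 \<or> \<alpha>1 - \<alpha>2 = - (2 * \<alpha>3))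
       | Bra k1 k2 \<Rightarrow> N_mon H = 0 \<and>
           (\<alpha>1 - \<alpha>2 = - of_nat k2 / of_nat (k1 + k2) \<or>
            \<alpha>1 - \<alpha>2 = - (- of_nat k2 / of_nat (k1 + k2)))
       | Reg_semisimple k1 \<alpha>4 \<Rightarrow> N_mon H = 0 \<and> (\<alpha>1 - \<alpha>2 = \<alpha>4 \<or> \<alpha>1 - \<alpha>2 = - \<alpha>4)
       | Reg_nilpotent kt \<alpha>4 \<Rightarrow> N_mon H \<noteq> 0 \<and> \<alpha>1 - \<alpha>2 = of_int \<bar>\<alpha>4\<bar>
       | Log k1 \<Rightarrow> N_mon H = 0 \<and> (\<alpha>1 - \<alpha>2 = 1 \<or> \<alpha>1 - \<alpha>2 = - 1))}"
proof (intro set_eqI, clarify, goal_cases)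
  case (1 X c1 \<rho>)
  show ?case
  proof (cases "admissible X")
    case adm: True
    note semisimple = unfolding_semisimple_iff[OF assms(1,3) adm]
    have double_half: "2 * (x / (2 * y)) = x / y" for x y :: complex by simp
    show ?thesis
    proof (cases X)
      case (Reg_nilpotent kt \<alpha>4)
      then show ?thesis
        using adm unfolding_nilpotent_iff[OF assms(1,3), of kt \<alpha>4 c1 \<rho>] by simp
    next
      case (Sem_odd k1 k2)
      have "2 * te_beta X = (of_nat k1 - of_nat k2) / of_nat (k1 + k2)"
        unfolding Sem_odd te_beta.simps by (rule double_half)
      from semisimple[OF this] show ?thesis
        using adm unfolding Sem_odd by (simp del: of_nat_add)
    next
      case (Sem_even k1 k2 \<zeta>)
      have "2 * te_beta X = (of_nat k1 - of_nat k2) / of_nat (k1 + k2)"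
        unfolding Sem_even te_beta.simps by (rule double_half)
      from semisimple[OF this] show ?thesis
        using adm unfolding Sem_even by (simp del: of_nat_add)
    next
      case (Sem_eq k1 k2 \<alpha>3)
      have "2 * te_beta X = 2 * \<alpha>3"
        by (simp add: Sem_eq)
      from semisimple[OF this] show ?thesis
        using adm unfolding Sem_eq by (simp del: of_nat_add)
    next
      case (Bra k1 k2)
      have "2 * te_beta X = - of_nat k2 / of_nat (k1 + k2)"
        unfolding Bra te_beta.simps by (rule double_half)
      from semisimple[OF this] show ?thesis
        using adm unfolding Bra by (simp del: of_nat_add)
    next
      case (Reg_semisimple k1 \<alpha>4)
      have "2 * te_beta X = \<alpha>4"
        by (simp add: Reg_semisimple)
      from semisimple[OF this] show ?thesis
        using adm unfolding Reg_semisimple by (simp del: of_nat_add)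
    next
      case (Log k1)
      have "2 * te_beta X = -1"
        by (simp add: Log)
      from semisimple[OF this] show ?thesis
        using adm unfolding Log by auto
    qed
  qed simp
qed

end
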